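(* Let $F:\mathbb{R}^d\rightrightarrows\mathbb{R}^d$ have nonempty, convex and compact values and be $L$-Lipschitz with respect to $|\cdot|_\infty$ with $L>0$, let $0<h\le\frac{1}{4L}$, $\rho>0$, $\alpha^*=(1+Lh)\rho/2$ and $0\le\beta^*<\min\{(1-3Lh)\rho,(1-Lh)\rho/2\}$. Let $\Phi_{\alpha^*,\beta^*}$ and $\Phi^\partial_{\alpha^*,\beta^*}$ be set-valued maps with $\Phi_{\alpha^*}(x)\subset\Phi_{\alpha^*,\beta^*}(x)\subset B_{\beta^*}(\Phi_{\alpha^*}(x))$ and $\Phi^\partial_{\alpha^*}(x)\subset\Phi^\partial_{\alpha^*,\beta^*}(x)\subset B_{\beta^*}(\Phi^\partial_{\alpha^*}(x))$ for all $x\in\mathbb{R}^d$. Let $M\subset\Delta_\rho$ be compact and chain-connected. Put $$\hat\kappa:=\frac{2+2Lh}{1-Lh}\alpha^*+\frac{3+Lh}{1-Lh}\beta^*+2(1+Lh)\rho,$$ $$S_0^0:=\Phi_{\alpha^*,\beta^*}(\partial_\rho^0M)\cap B_{\hat\kappa}\big(\Phi^\partial_{\alpha^*,\beta^*}(\partial_\rho^0M)\big)\cap\Delta_\rho,\qquad S_0^{-1}:=\Phi^\partial_{\alpha^*,\beta^*}(\partial_\rho^{-1}M)\cap\Delta_\rho,$$ $$S_1:=\Phi^\partial_{\alpha^*,\beta^*}(\partial_\rho^1M\cup\partial_\rho^2M)\cap\Delta_\rho.$$ Then the boundary Euler scheme is well-defined, i.e. it computes the correct sets: $$\partial_\rho^1(\Phi_{\alpha^*,\beta^*}(M))=\{x\in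 S_1:\ \operatorname{dist}(x,S_0^0\cup S_0^{-1})=\rho\}$$ and $$\partial_\rho^0(\Phi_{\alpha^*,\beta^*}(M))=\{x\in S_0^0\cup S_0^{-1}:\ \operatorname{dist}(x,\partial_\rho^1(\Phi_{\alpha^*,\beta^*}(M)))=\rho\}.$$
   Context: All distances are in the maximum norm $|\cdot|_\infty$ on $\mathbb{R}^d$: $\operatorname{dist}(x,A)=\inf_{a\in A}|x-a|_\infty$ (equal to $+\infty$ if $A=\emptyset$), $B_r(A)=\{x\in\mathbb{R}^d:\operatorname{dist}(x,A)\le r\}$. $F$ is $L$-Lipschitz if the Hausdorff distance (in $|\cdot|_\infty$) of $F(x)$ and $F(\tilde x)$ is at most $L|x-\tilde x|_\infty$ for all $x,\tilde x$. For a set-valued map $\Psi$ and a set $S$, $\Psi(S)=\bigcup_{x\in S}\Psi(x)$. Euler maps: $\Phi(x)=x+hF(x)$, $\Phi_\alpha(x)=B_\alpha(\Phi(x))$, $\Phi_\alpha^\partial(x)=B_\alpha(\partial\Phi(x))$, where $\partial\Phi(x)$ is the topological boundary of the set $\Phi(x)$ in $\mathbb{R}^d$. Grid notions: $\Delta_\rho=\rho\mathbb{Z}^d$. For $A\subset\mathbb{R}^d$, $\partial_\rho^0A=\{a\in A\cap\Delta_\rho:\exists x\in\Delta_\rho\setminus A \text{ with } |x-a|_\infty=\rho\}$; and for integers $k\ge1$, $\partial_\rho^kA=\{x\in\Delta_\rho\setminus A:\operatorname{dist}(x,\partial_\rho^0A)=k\rho\}$, $\partial_\rho^{-k}A=\{a\in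 A\cap\Delta_\rho:\operatorname{dist}(a,\partial_\rho^0A)=k\rho\}$. A chain connecting $x,\tilde x\in\Delta_\rho$ is a finite sequence $(c_n)_{n=0}^N\subset\Delta_\rho$ with $c_0=x$, $c_N=\tilde x$ and $|c_{n+1}-c_n|_\infty=\rho$ for $n=0,\dots,N-1$ ($N=0$ is allowed if $x=\tilde x$). A set $M\subset\Delta_\rho$ is chain-connected if any two of its points are connected by a chain contained in $M$. The boundary Euler scheme takes $\partial_\rho^0M,\partial_\rho^1M$ as input, forms $\partial_\rho^{-1}M$, $\partial_\rho^2M$, then $S_0^0,S_0^{-1},S_1$, and outputs the two sets on the right-hand sides in the claim. *)

theory Defs
  imports "HOL-Analysis.Analysis"
begin

text \<open>All metric notions refer to the maximum norm \<open>infnorm\<close>, not to the Euclidean \<open>dist\<close> of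
  \<open>real ^ 'n\<close>. Distances to sets live in \<^typ>\<open>ereal\<close>, so that the distance to the empty set
  is \<open>\<infinity>\<close>.\<close>

definition max_dist :: "real ^ 'n \<Rightarrow> (real ^ 'n) set \<Rightarrow> ereal" where
  "max_dist x A = (INF a\<in>A. ereal (infnorm (x - a)))"

definition max_nbhd :: "real \<Rightarrow> (real ^ 'n) set \<Rightarrow> (real ^ 'n) set" where
  "max_nbhd r A = {x. max_dist x A \<le> ereal r}"

text \<open>Meaningful for nonempty sets only (in \<^typ>\<open>ereal\<close> the empty supremum is \<open>-\<infinity>\<close>).\<close>

definition hausdorff_max_dist :: "(real ^ 'n) set \<Rightarrow> (real ^ 'n) set \<Rightarrow> ereal" where
  "hausdorff_max_dist A B = max (SUP a\<in>A. max_dist a B) (SUP b\<in>B. max_dist b A)"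

definition set_lipschitz :: "real \<Rightarrow> (real ^ 'n \<Rightarrow> (real ^ 'n) set) \<Rightarrow> bool" where
  "set_lipschitz L F \<longleftrightarrow>
     (\<forall>x y. hausdorff_max_dist (F x) (F y) \<le> ereal (L * infnorm (x - y)))"

definition euler_map :: "(real ^ 'n \<Rightarrow> (real ^ 'n) set) \<Rightarrow> real \<Rightarrow> real ^ 'n \<Rightarrow> (real ^ 'n) set" where
  "euler_map F h x = (\<lambda>v. x + h *\<^sub>R v) ` F x"

definition blown_euler_map ::
    "(real ^ 'n \<Rightarrow> (real ^ 'n) set) \<Rightarrow> real \<Rightarrow> real \<Rightarrow> real ^ 'n \<Rightarrow> (real ^ 'n) set" where
  "blown_euler_map F h \<alpha> x = max_nbhd \<alpha> (euler_map F h x)"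

definition blown_boundary_euler_map ::
    "(real ^ 'n \<Rightarrow> (real ^ 'n) set) \<Rightarrow> real \<Rightarrow> real \<Rightarrow> real ^ 'n \<Rightarrow> (real ^ 'n) set" where
  "blown_boundary_euler_map F h \<alpha> x = max_nbhd \<alpha> (frontier (euler_map F h x))"

definition grid :: "real \<Rightarrow> (real ^ 'n) set" where
  "grid \<rho> = {x. \<forall>i. \<exists>k::int. x $ i = \<rho> * of_int k}"

definition grid_boundary0 :: "real \<Rightarrow> (real ^ 'n) set \<Rightarrow> (real ^ 'n) set" where
  "grid_boundary0 \<rho> A = {a \<in> A \<inter> grid \<rho>. \<exists>x \<in> grid \<rho> - A. infnorm (x - a) = \<rho>}"

text \<open>The boundary layers: positive indices are layers outside of \<open>A\<close>, negative ones inside.\<close>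

definition grid_boundary :: "real \<Rightarrow> int \<Rightarrow> (real ^ 'n) set \<Rightarrow> (real ^ 'n) set" where
  "grid_boundary \<rho> k A =
     (if k = 0 then grid_boundary0 \<rho> A
      else if k > 0 then {x \<in> grid \<rho> - A. max_dist x (grid_boundary0 \<rho> A) = ereal (of_int k * \<rho>)}
      else {a \<in> A \<inter> grid \<rho>. max_dist a (grid_boundary0 \<rho> A) = ereal (of_int (- k) * \<rho>)})"

definition grid_chain :: "real \<Rightarrow> nat \<Rightarrow> (nat \<Rightarrow> real ^ 'n) \<Rightarrow> real ^ 'n \<Rightarrow> real ^ 'n \<Rightarrow> bool" where
  "grid_chain \<rho> N c x y \<longleftrightarrow>
     (\<forall>n\<le>N. c n \<in> grid \<rho>) \<and> c 0 = x \<and> c N = y \<and> (\<forall>n<N. infnorm (c (Suc n) - c n) = \<rho>)"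

definition chain_connected :: "real \<Rightarrow> (real ^ 'n) set \<Rightarrow> bool" where
  "chain_connected \<rho> M \<longleftrightarrow>
     (\<forall>x\<in>M. \<forall>y\<in>M. \<exists>N c. grid_chain \<rho> N c x y \<and> (\<forall>n\<le>N. c n \<in> M))"

end

theory Submission
  imports Defs
begin

text \<open>
  Write \<open>G(x) = x + h F(x)\<close> and \<open>\<Phi>(M)\<close> for the image of \<open>M\<close>. Two facts drive the proof. First, since
  \<open>L h < 1\<close>, a point at distance \<open>r\<close> from \<open>G(m)\<close> lies in \<open>G(z)\<close>, and even on its frontier if it is
  outside \<open>G(m)\<close>, for some \<open>z\<close> with \<open>|z - m| \<le> r / (1 - L h)\<close>. Rounding \<open>z\<close> to the grid costs
  \<open>\<rho> / 2\<close>, which the blow-up by \<open>\<alpha>\<close> absorbs, and the bounds on \<open>\<beta>\<close> keep the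
  rounded point within one or two layers of \<open>m\<close>. Second, for compact convex sets the frontiers are
  no further apart than the sets, which transfers frontier points between neighbouring grid points.

  The delicate inclusion is that a grid point \<open>x\<close> of \<open>\<Phi>(M)\<close> that is also produced from outside \<open>M\<close> by
  the boundary map is produced by the boundary layer of \<open>M\<close>. Here the solution set
  \<open>{z. x \<in> G(z)}\<close> has points near \<open>M\<close> and near the outside; it is connected in a discrete sense, by
  repeatedly projecting midpoints onto it, so its roundings cross the boundary layer of \<open>M\<close>.
\<close>

subsection \<open>Neighbourhoods in the maximum norm\<close>

lemma infnorm_triangle3: "infnorm (x - z) \<le> infnorm (x - y) + infnorm (y - z)"
  using infnorm_triangle[of "x - y" "y - z"] by simp

lemma infnorm_attained:
  fixes x :: "real ^ 'n"
  shows "\<exists>i. infnorm x = \<bar>x $ i\<bar>"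
proof -
  have "{\<bar>x $ i\<bar> |i. i \<in> UNIV} = range (\<lambda>i. \<bar>x $ i\<bar>)" by auto
  then have "infnorm x = Max (range (\<lambda>i. \<bar>x $ i\<bar>))"
    by (simp add: infnorm_cart cSup_eq_Max)
  moreover have "Max (range (\<lambda>i. \<bar>x $ i\<bar>)) \<in> range (\<lambda>i. \<bar>x $ i\<bar>)"
    by (rule Max_in) auto
  ultimately show ?thesis by (metis imageE)
qed

lemma infnorm_le_iff:
  fixes x :: "real ^ 'n"
  shows "infnorm x \<le> r \<longleftrightarrow> (\<forall>i. \<bar>x $ i\<bar> \<le> r)"
  using infnorm_attained[of x] component_le_infnorm_cart[of x] by (metis order_trans)

lemma compact_infnorm_cball:
  fixes x :: "real ^ 'n"
  shows "compact {z. infnorm (z - x) \<le> r}"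
proof -
  have "bounded {z. infnorm (z - x) \<le> r}"
  proof (rule bounded_subset[OF bounded_cball[of x "sqrt DIM(real ^ 'n) * r"]], safe)
    fix z assume "infnorm (z - x) \<le> r"
    then have "norm (z - x) \<le> sqrt DIM(real ^ 'n) * r"
      by (intro order_trans[OF norm_le_infnorm] mult_left_mono) auto
    then show "z \<in> cball x (sqrt DIM(real ^ 'n) * r)" by (simp add: dist_norm norm_minus_commute)
  qed
  moreover have "closed {z. infnorm (z - x) \<le> r}"
    by (intro closed_Collect_le continuous_intros)
  ultimately show ?thesis by (simp add: compact_eq_bounded_closed)
qed

lemma convex_infnorm_cball: "convex {z. infnorm (z - x) \<le> r}"
proof (rule convexI)
  fix y z and u v :: real
  assume yz: "y \<in> {z. infnorm (z - x) \<le> r}" "z \<in> {z. infnorm (z - x) \<le> r}"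
    and uv: "0 \<le> u" "0 \<le> v" "u + v = 1"
  have "u *\<^sub>R y + v *\<^sub>R z - x = u *\<^sub>R (y - x) + v *\<^sub>R (z - x)"
    using uv by (simp add: algebra_simps flip: scaleR_add_left)
  then have "infnorm (u *\<^sub>R y + v *\<^sub>R z - x) \<le> u * infnorm (y - x) + v * infnorm (z - x)"
    using infnorm_triangle[of "u *\<^sub>R (y - x)" "v *\<^sub>R (z - x)"] uv by (simp add: infnorm_mul)
  also have "\<dots> \<le> u * r + v * r" using yz uv by (intro add_mono mult_left_mono) auto
  finally show "u *\<^sub>R y + v *\<^sub>R z \<in> {z. infnorm (z - x) \<le> r}"
    using uv by (simp flip: distrib_right)
qed

text \<open>The infimum need not be attained, hence the slack \<open>e\<close>. For empty
  \<open>A\<close> both sides fail, in accordance with the distance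
  \<open>\<infinity>\<close>.\<close>

lemma mem_max_nbhd_iff:
  "x \<in> max_nbhd r A \<longleftrightarrow> (\<forall>e>0. \<exists>a\<in>A. infnorm (x - a) < r + e)"
proof -
  have "x \<in> max_nbhd r A \<longleftrightarrow> (\<forall>y>ereal r. \<exists>a\<in>A. ereal (infnorm (x - a)) < y)"
    by (simp add: max_nbhd_def max_dist_def INF_le_iff)
  also have "\<dots> \<longleftrightarrow> (\<forall>e>0. \<exists>a\<in>A. infnorm (x - a) < r + e)"
  proof
    assume *: "\<forall>y>ereal r. \<exists>a\<in>A. ereal (infnorm (x - a)) < y"
    show "\<forall>e>0. \<exists>a\<in>A. infnorm (x - a) < r + e"
      using *[rule_format, of "ereal (r + _)"] by auto
  next
    assume *: "\<forall>e>0. \<exists>a\<in>A. infnorm (x - a) < r + e"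
    show "\<forall>y>ereal r. \<exists>a\<in>A. ereal (infnorm (x - a)) < y"
    proof (intro allI impI)
      fix y assume "ereal r < y"
      then obtain s where s: "r < s" "ereal s \<le> y"
        by (metis ereal_dense2 ereal_less_eq(3) less_ereal.simps(1) order_less_imp_le)
      then obtain a where "a \<in> A" "infnorm (x - a) < s"
        using *[rule_format, of "s - r"] by auto
      then show "\<exists>a\<in>A. ereal (infnorm (x - a)) < y"
        using s by (metis less_ereal.simps(1) order_less_le_trans)
    qed
  qed
  finally show ?thesis .
qed

lemma max_nbhdI: "a \<in> A \<Longrightarrow> infnorm (x - a) \<le> r \<Longrightarrow> x \<in> max_nbhd r A"
  unfolding mem_max_nbhd_iff by (meson less_add_same_cancel1 order_le_less_trans)

lemma max_nbhd_mono: "A \<subseteq> B \<Longrightarrow> r \<le> s \<Longrightarrow> max_nbhd r A \<subseteq> max_nbhd s B"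
  unfolding mem_max_nbhd_iff subset_iff by (meson add_right_mono order_less_le_trans)

lemma max_nbhd_compactE:
  assumes "x \<in> max_nbhd r A" and "compact A"
  obtains a where "a \<in> A" and "infnorm (x - a) \<le> r"
proof -
  have ne: "A \<noteq> {}" using assms(1)[unfolded mem_max_nbhd_iff, rule_format, of 1] by auto
  have "continuous_on A (\<lambda>a. infnorm (x - a))" by (intro continuous_intros)
  then obtain a where a: "a \<in> A" "\<And>b. b \<in> A \<Longrightarrow> infnorm (x - a) \<le> infnorm (x - b)"
    using continuous_attains_inf[OF assms(2) ne] by meson
  have "infnorm (x - a) \<le> r"
  proof (rule field_le_epsilon)
    fix e :: real assume "0 < e"
    then obtain b where "b \<in> A" "infnorm (x - b) < r + e"
      using assms(1) by (auto simp: mem_max_nbhd_iff)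
    then show "infnorm (x - a) \<le> r + e" using a(2)[of b] by linarith
  qed
  then show thesis using a(1) that by blast
qed

lemma max_nbhd_zero:
  assumes "compact A"
  shows "max_nbhd 0 A = A"
proof
  show "max_nbhd 0 A \<subseteq> A"
    using max_nbhd_compactE[OF _ assms] infnorm_pos_lt by (metis not_le right_minus_eq subsetI)
  show "A \<subseteq> max_nbhd 0 A" using max_nbhdI by (force simp: infnorm_0)
qed

lemma max_nbhd_add:
  assumes "x \<in> max_nbhd r A" and "infnorm (y - x) \<le> s"
  shows "y \<in> max_nbhd (r + s) A"
  unfolding mem_max_nbhd_iff
proof (intro allI impI)
  fix e :: real assume "0 < e"
  then obtain a where "a \<in> A" "infnorm (x - a) < r + e"
    using assms(1) by (auto simp: mem_max_nbhd_iff)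
  then show "\<exists>a\<in>A. infnorm (y - a) < r + s + e"
    using assms(2) infnorm_triangle3[of y a x] by (intro bexI[of _ a]) auto
qed

lemma max_nbhd_trans:
  assumes "A \<subseteq> max_nbhd s B"
  shows "max_nbhd r A \<subseteq> max_nbhd (r + s) B"
proof
  fix x assume x: "x \<in> max_nbhd r A"
  show "x \<in> max_nbhd (r + s) B"
    unfolding mem_max_nbhd_iff
  proof (intro allI impI)
    fix e :: real assume e: "0 < e"
    then obtain a where a: "a \<in> A" "infnorm (x - a) < r + e / 2"
      using x by (auto simp: mem_max_nbhd_iff dest: spec[of _ "e / 2"])
    then obtain b where "b \<in> B" "infnorm (a - b) < s + e / 2"
      using assms e by (auto simp: mem_max_nbhd_iff subset_iff dest!: spec[of _ a] spec[of _ "e / 2"])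
    then show "\<exists>b\<in>B. infnorm (x - b) < r + s + e"
      using a infnorm_triangle3[of x b a] by (intro bexI[of _ b]) auto
  qed
qed

subsection \<open>Boundaries of compact convex sets\<close>

text \<open>The dual of the maximum norm is the sum norm: with the negated signs of \<open>a\<close>
  as entries of \<open>w\<close>, \<open>a \<bullet> w\<close> is minus the sum norm of
  \<open>a\<close>. One \<open>w\<close> serves all radii \<open>s\<close>.\<close>

lemma infnorm_dual_minimizer:
  fixes a :: "real ^ 'n"
  obtains w where "infnorm w \<le> 1" and "\<And>v s. infnorm v \<le> s \<Longrightarrow> s * (a \<bullet> w) \<le> a \<bullet> v"
proof
  define w where "w = (\<chi> i. - sgn (a $ i))"
  show "infnorm w \<le> 1" by (simp add: infnorm_le_iff w_def sgn_if)
  have w: "a \<bullet> w = (\<Sum>i\<in>UNIV. - \<bar>a $ i\<bar>)"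
    by (simp add: inner_vec_def w_def abs_sgn sum_negf)
  fix v :: "real ^ 'n" and s :: real assume "infnorm v \<le> s"
  then have v: "\<bar>v $ i\<bar> \<le> s" for i by (simp add: infnorm_le_iff)
  have "s * - \<bar>a $ i\<bar> \<le> a $ i * v $ i" for i
  proof -
    have "- (a $ i * v $ i) \<le> \<bar>a $ i\<bar> * \<bar>v $ i\<bar>" by (metis abs_ge_minus_self abs_mult)
    also have "\<dots> \<le> \<bar>a $ i\<bar> * s" by (rule mult_left_mono[OF v]) simp
    finally show ?thesis by (simp add: mult.commute)
  qed
  then show "s * (a \<bullet> w) \<le> a \<bullet> v"
    unfolding w by (simp add: inner_vec_def sum_distrib_left del: mult_minus_right) (rule sum_mono)
qed

text \<open>A cancellation law for Minkowski sums with balls, in local form.\<close>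

lemma infnorm_cball_cancel:
  fixes B :: "(real ^ 'n) set"
  assumes B: "convex B" "compact B"
    and ball: "{w. infnorm (w - y) \<le> r} \<subseteq> max_nbhd (r + t) B" and r: "0 \<le> r" and t: "0 \<le> t"
  shows "y \<in> max_nbhd t B"
proof (rule ccontr)
  assume y: "y \<notin> max_nbhd t B"
  let ?U = "{e :: real ^ 'n. infnorm (e - 0) \<le> t}"
  \<comment> \<open>The Minkowski sum of \<open>B\<close> and the closed \<open>t\<close>-ball is
    closed, convex and misses \<open>y\<close>, so a hyperplane with normal \<open>a\<close>
    separates them.\<close>
  let ?S = "\<Union>b\<in>B. \<Union>e\<in>?U. {b + e}"
  have "convex ?S" by (intro convex_sums B convex_infnorm_cball)
  moreover have "closed ?S"
    by (intro compact_imp_closed compact_sums' B compact_infnorm_cball)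
  moreover have "y \<notin> ?S"
  proof
    assume "y \<in> ?S"
    then obtain b e where "b \<in> B" "infnorm e \<le> t" "y = b + e" by auto
    then show False using y max_nbhdI[of b B y t] by simp
  qed
  ultimately have "\<exists>a c. a \<bullet> y < c \<and> (\<forall>x\<in>?S. a \<bullet> x > c)"
    by (rule separating_hyperplane_closed_point)
  then obtain a c where ac: "a \<bullet> y < c" "\<forall>x\<in>?S. a \<bullet> x > c" by metis
  obtain w where w: "infnorm w \<le> 1" "\<And>v s. infnorm v \<le> s \<Longrightarrow> s * (a \<bullet> w) \<le> a \<bullet> v"
    using infnorm_dual_minimizer[of a] by blast
  \<comment> \<open>At this point of the \<open>r\<close>-ball about \<open>y\<close> the functional
    \<open>a\<close> is least, yet some \<open>b\<close> is within \<open>r + t\<close>. The terms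
    with \<open>r\<close> cancel, so \<open>a \<bullet> y\<close> is at least the value of
    \<open>a\<close> at \<open>b + t *\<^sub>R w\<close>, a point of \<open>?S\<close>.\<close>
  have "infnorm (r *\<^sub>R w) \<le> r"
    using w(1) r by (simp add: infnorm_mul mult_left_le)
  then have "y + r *\<^sub>R w \<in> max_nbhd (r + t) B" using ball by auto
  then obtain b where b: "b \<in> B" "infnorm (y + r *\<^sub>R w - b) \<le> r + t"
    using B(2) by (rule max_nbhd_compactE)
  have "t *\<^sub>R w \<in> ?U" using w(1) t by (simp add: infnorm_mul mult_left_le)
  then have "c < a \<bullet> (b + t *\<^sub>R w)" using b(1) by (intro ac(2)[rule_format]) blast
  moreover have "(r + t) * (a \<bullet> w) \<le> a \<bullet> (y + r *\<^sub>R w - b)" using w(2) b(2) by blast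
  ultimately show False using ac(1) by (simp add: algebra_simps)
qed

lemma infnorm_closed_segment_le:
  assumes "z \<in> closed_segment x y" "infnorm (x - a) \<le> r" "infnorm (y - a) \<le> r"
  shows "infnorm (z - a) \<le> r"
proof -
  have "closed_segment x y \<subseteq> {z. infnorm (z - a) \<le> r}"
    using assms by (intro closed_segment_subset convex_infnorm_cball) auto
  then show ?thesis using assms(1) by auto
qed

text \<open>The segment from \<open>p\<close> to \<open>q\<close> meets the frontier, and it stays
  in the \<open>r\<close>-ball about \<open>x\<close> because that ball is convex.\<close>

lemma frontier_between:
  assumes "p \<in> A" "q \<notin> A" "infnorm (p - x) \<le> r" "infnorm (q - x) \<le> r"
  shows "x \<in> max_nbhd r (frontier A)"
proof -
  have "closed_segment p q \<inter> frontier A \<noteq> {}"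
    using assms(1,2) by (intro connected_Int_frontier) auto
  then obtain z where "z \<in> closed_segment p q" "z \<in> frontier A" by auto
  then show ?thesis
    using infnorm_closed_segment_le[OF _ assms(3,4)] max_nbhdI[of z _ x r] infnorm_sub[of x z] by simp
qed

text \<open>If the \<open>r\<close>-ball about \<open>x\<close> stayed inside \<open>A\<close>,
  cancelling \<open>r\<close> would put \<open>x\<close> within \<open>t\<close> of
  \<open>B\<close>. So this ball both meets and leaves \<open>A\<close>.\<close>

lemma frontier_near:
  assumes x: "x \<in> max_nbhd r A" and A: "compact A" "convex A" and B: "compact B" "convex B"
    and AB: "A \<subseteq> max_nbhd (r + t) B" and xB: "x \<notin> max_nbhd t B" and r: "0 \<le> r" and t: "0 \<le> t"
  shows "x \<in> max_nbhd r (frontier A)"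
proof -
  obtain p where p: "p \<in> A" "infnorm (p - x) \<le> r"
    using max_nbhd_compactE[OF x A(1)] infnorm_sub by metis
  have "\<not> {w. infnorm (w - x) \<le> r} \<subseteq> A"
    using infnorm_cball_cancel[OF B(2,1) _ r t, of x] AB xB by blast
  then obtain q where "q \<notin> A" "infnorm (q - x) \<le> r" by blast
  then show ?thesis using p frontier_between by blast
qed

text \<open>If the \<open>(s + e)\<close>-ball about a frontier point \<open>x\<close> of
  \<open>A\<close> lay in \<open>B\<close>, cancelling \<open>s\<close> would leave an
  \<open>e\<close>-ball about \<open>x\<close> inside \<open>A\<close>. So it leaves
  \<open>B\<close>, which it also meets; then \<open>e\<close> tends to \<open>0\<close>.\<close>

lemma frontier_subset_max_nbhd_frontier:
  assumes A: "compact A" "convex A" and B: "compact B" "convex B"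
    and AB: "A \<subseteq> max_nbhd s B" and BA: "B \<subseteq> max_nbhd s A" and s: "0 \<le> s"
  shows "frontier A \<subseteq> max_nbhd s (frontier B)"
proof
  fix x assume x: "x \<in> frontier A"
  then have xA: "x \<in> A" using frontier_subset_compact[OF A(1)] by blast
  then obtain p where p: "p \<in> B" "infnorm (p - x) \<le> s"
    using AB max_nbhd_compactE[OF _ B(1)] infnorm_sub by (metis subset_iff)
  have "x \<in> max_nbhd (s + e) (frontier B)" if e: "0 < e" for e
  proof -
    have "\<not> {w. infnorm (w - x) \<le> s + e} \<subseteq> B"
    proof
      assume sub: "{w. infnorm (w - x) \<le> s + e} \<subseteq> B"
      have "ball x e \<subseteq> A"
      proof
        fix y assume "y \<in> ball x e"
        then have y: "infnorm (y - x) \<le> e"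
          using infnorm_le_norm[of "y - x"] by (simp add: dist_norm norm_minus_commute)
        have "w \<in> max_nbhd (s + 0) A" if "infnorm (w - y) \<le> s" for w
          using that y sub BA infnorm_triangle3[of w x y] by (auto simp: subset_iff)
        then show "y \<in> A"
          using infnorm_cball_cancel[OF A(2,1) _ s order_refl, of y] max_nbhd_zero[OF A(1)] by blast
      qed
      then have "x \<in> interior A" using e mem_interior by blast
      then show False using x by (simp add: frontier_def)
    qed
    then obtain q where "q \<notin> B" "infnorm (q - x) \<le> s + e" by blast
    then show ?thesis using frontier_between[of p B q x "s + e"] p e by auto
  qed
  then show "x \<in> max_nbhd s (frontier B)"
    unfolding mem_max_nbhd_iff
  proof (intro allI impI)
    fix e :: real assume "0 < e"
    then show "\<exists>b\<in>frontier B. infnorm (x - b) < s + e"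
      using \<open>\<And>e. 0 < e \<Longrightarrow> x \<in> max_nbhd (s + e) (frontier B)\<close>[of "e / 2"]
      by (force simp: mem_max_nbhd_iff dest!: spec[of _ "e / 2"])
  qed
qed

subsection \<open>Euler maps of Lipschitz right-hand sides\<close>

locale lipschitz_euler =
  fixes F :: "real ^ 'n \<Rightarrow> (real ^ 'n) set" and L h :: real
  assumes F_convex: "convex (F x)"
    and F_compact: "compact (F x)"
    and F_lipschitz: "set_lipschitz L F"
    and L_pos: "0 < L"
    and h_pos: "0 < h"
    and Lh_le: "L * h \<le> 1 / 4"
begin

abbreviation G :: "real ^ 'n \<Rightarrow> (real ^ 'n) set"
  where "G \<equiv> euler_map F h"

lemma Lh_pos: "0 < L * h"
  using L_pos h_pos by simp

lemma compact_G: "compact (G x)"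
  unfolding euler_map_def by (intro compact_continuous_image continuous_intros F_compact)

lemma convex_G: "convex (G x)"
proof -
  have "G x = (+) x ` ((*\<^sub>R) h ` F x)" by (auto simp: euler_map_def image_image)
  then show ?thesis by (simp add: convex_translation convex_scaling F_convex)
qed

lemma mem_G_iff: "x \<in> G z \<longleftrightarrow> (1 / h) *\<^sub>R (x - z) \<in> F z"
  using h_pos by (force simp: euler_map_def)

lemma F_selection:
  assumes "v \<in> F x"
  obtains w where "w \<in> F y" and "infnorm (v - w) \<le> L * infnorm (x - y)"
proof -
  have "max_dist v (F y) \<le> (SUP a\<in>F x. max_dist a (F y))" using assms by (rule SUP_upper)
  also have "\<dots> \<le> hausdorff_max_dist (F x) (F y)" by (simp add: hausdorff_max_dist_def)
  also have "\<dots> \<le> ereal (L * infnorm (x - y))" using F_lipschitz by (simp add: set_lipschitz_def)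
  finally have "v \<in> max_nbhd (L * infnorm (x - y)) (F y)" by (simp add: max_nbhd_def)
  then show thesis using F_compact that by (rule max_nbhd_compactE)
qed

lemma G_lipschitz:
  assumes "infnorm (x - y) \<le> r"
  shows "G x \<subseteq> max_nbhd ((1 + L * h) * r) (G y)"
proof
  fix z assume "z \<in> G x"
  then obtain v where v: "v \<in> F x" "z = x + h *\<^sub>R v" by (auto simp: euler_map_def)
  obtain w where w: "w \<in> F y" "infnorm (v - w) \<le> L * infnorm (x - y)"
    using F_selection[OF v(1)] by blast
  have "z - (y + h *\<^sub>R w) = (x - y) + h *\<^sub>R (v - w)" by (simp add: v algebra_simps)
  then have "infnorm (z - (y + h *\<^sub>R w)) \<le> infnorm (x - y) + infnorm (h *\<^sub>R (v - w))"
    by (metis infnorm_triangle)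
  also have "\<dots> = infnorm (x - y) + h * infnorm (v - w)"
    using h_pos by (simp only: infnorm_mul abs_of_pos)
  also have "\<dots> \<le> infnorm (x - y) + h * (L * infnorm (x - y))"
    using w(2) h_pos by (intro add_left_mono mult_left_mono) auto
  also have "\<dots> = (1 + L * h) * infnorm (x - y)" by (simp add: algebra_simps)
  also have "\<dots> \<le> (1 + L * h) * r" using assms Lh_pos by (intro mult_left_mono) auto
  finally show "z \<in> max_nbhd ((1 + L * h) * r) (G y)"
    using w(1) by (intro max_nbhdI[of "y + h *\<^sub>R w"]) (auto simp: euler_map_def)
qed

text \<open>The distance from a limit \<open>v\<close> to \<open>F z\<close> is at most the error in
  the second component plus \<open>L\<close> times the error in the first, and \<open>F z\<close> is
  compact.\<close>

lemma closed_graph_F: "closed {(z, v). v \<in> F z}"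
  unfolding closed_sequential_limits
proof (intro allI impI, elim conjE)
  fix s :: "nat \<Rightarrow> _" and p
  assume s: "\<forall>n. s n \<in> {(z, v). v \<in> F z}" and lim: "s \<longlonglongrightarrow> p"
  obtain z v where p: "p = (z, v)" by fastforce
  have zv: "(\<lambda>n. fst (s n)) \<longlonglongrightarrow> z" "(\<lambda>n. snd (s n)) \<longlonglongrightarrow> v"
    using tendsto_fst[OF lim] tendsto_snd[OF lim] p by auto
  have "v \<in> max_nbhd 0 (F z)"
    unfolding mem_max_nbhd_iff
  proof (intro allI impI)
    fix e :: real assume e: "0 < e"
    have "(\<lambda>n. infnorm (v - snd (s n)) + L * infnorm (fst (s n) - z))
        \<longlonglongrightarrow> infnorm (v - v) + L * infnorm (z - z)"
      by (intro tendsto_intros zv)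
    then have "(\<lambda>n. infnorm (v - snd (s n)) + L * infnorm (fst (s n) - z)) \<longlonglongrightarrow> 0"
      by (simp add: infnorm_0)
    then have "\<forall>\<^sub>F n in sequentially. infnorm (v - snd (s n)) + L * infnorm (fst (s n) - z) < e"
      using e by (rule order_tendstoD)
    then obtain n where n: "infnorm (v - snd (s n)) + L * infnorm (fst (s n) - z) < e"
      by (auto simp: eventually_sequentially)
    have "snd (s n) \<in> F (fst (s n))" using s by (simp add: case_prod_unfold)
    then obtain w where "w \<in> F z" "infnorm (snd (s n) - w) \<le> L * infnorm (fst (s n) - z)"
      by (rule F_selection)
    then show "\<exists>a\<in>F z. infnorm (v - a) < 0 + e"
      using n infnorm_triangle3[of v w "snd (s n)"] by force
  qed
  then show "p \<in> {(z, v). v \<in> F z}" using max_nbhd_zero[OF F_compact] p by simp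
qed

lemma closed_preimage_G: "closed {z. x \<in> G z}"
proof -
  have "{z. x \<in> G z} = (\<lambda>z. (z, (1 / h) *\<^sub>R (x - z))) -` {(z, v). v \<in> F z}"
    by (auto simp: mem_G_iff)
  moreover have "continuous_on UNIV (\<lambda>z. (z, (1 / h) *\<^sub>R (x - z)))" by (intro continuous_intros)
  ultimately show ?thesis by (simp only: closed_vimage[OF closed_graph_F])
qed

text \<open>The equation \<open>x \<in> z + h F(z)\<close> is a fixed point problem for the set-valued contraction
  \<open>z \<mapsto> x - h F(z)\<close>. The constraint defining \<open>K\<close> is preserved by the fixed point iteration, while
  the residual shrinks by the factor \<open>L h\<close>, so a minimiser of the residual on \<open>K\<close> is a
  solution.\<close>

lemma preimage_near:
  assumes "x \<in> max_nbhd r (G m)"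
  obtains z where "x \<in> G z" and "infnorm (z - m) \<le> r / (1 - L * h)"
proof -
  define q where "q = 1 - L * h"
  have q: "0 < q" "q \<le> 1" using Lh_le Lh_pos by (auto simp: q_def)
  \<comment> \<open>\<open>f\<close> is the residual of \<open>(z, v)\<close>: it vanishes exactly
    if \<open>x = z + h *\<^sub>R v\<close>.\<close>
  define f where "f = (\<lambda>p. infnorm (x - fst p - h *\<^sub>R snd p))"
  define K where "K = {(z, v). v \<in> F z} \<inter> {p. f p + q * infnorm (fst p - m) \<le> r}"
  obtain g where "g \<in> G m" "infnorm (x - g) \<le> r"
    using max_nbhd_compactE[OF assms compact_G] by blast
  then obtain v0 where "(m, v0) \<in> K"
    by (auto simp: K_def f_def euler_map_def infnorm_0 diff_diff_eq)
  then have K_ne: "K \<noteq> {}" by blast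
  have f_cont: "continuous_on A f" for A unfolding f_def by (intro continuous_intros)
  have "closed K"
    unfolding K_def f_def by (intro closed_Int closed_graph_F closed_Collect_le continuous_intros)
  \<comment> \<open>A bounded displacement \<open>z - m\<close> and a bounded residual also bound
    \<open>v\<close>, so \<open>K\<close> is compact.\<close>
  moreover have "K \<subseteq> {z. infnorm (z - m) \<le> r / q} \<times> {v. infnorm (v - (1 / h) *\<^sub>R (x - m)) \<le> (r / q + r) / h}"
  proof safe
    fix z v assume "(z, v) \<in> K"
    then have zv: "f (z, v) + q * infnorm (z - m) \<le> r" by (simp add: K_def)
    have "0 \<le> f (z, v)" by (simp add: f_def infnorm_pos_le)
    then have "q * infnorm (z - m) \<le> r" using zv by linarith
    then show z: "infnorm (z - m) \<le> r / q" using q by (simp add: field_simps)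
    have fr: "f (z, v) \<le> r" using zv mult_nonneg_nonneg[of q "infnorm (z - m)"] q infnorm_pos_le[of "z - m"]
      by linarith
    have "v - (1 / h) *\<^sub>R (x - m) = (- 1 / h) *\<^sub>R ((z - m) + (x - z - h *\<^sub>R v))"
      using h_pos by (simp add: algebra_simps)
    then have "infnorm (v - (1 / h) *\<^sub>R (x - m)) = \<bar>- 1 / h\<bar> * infnorm ((z - m) + (x - z - h *\<^sub>R v))"
      by (simp only: infnorm_mul)
    also have "\<dots> = infnorm ((z - m) + (x - z - h *\<^sub>R v)) / h"
      using h_pos by simp
    also have "\<dots> \<le> (r / q + r) / h"
      using z fr infnorm_triangle[of "z - m" "x - z - h *\<^sub>R v"] h_pos
      by (intro divide_right_mono) (auto simp: f_def)
    finally show "infnorm (v - (1 / h) *\<^sub>R (x - m)) \<le> (r / q + r) / h" .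
  qed
  ultimately have "compact K"
    using compact_Times[OF compact_infnorm_cball compact_infnorm_cball]
    by (metis closed_Int_compact inf.orderE)
  then obtain p where "p \<in> K" "\<forall>p'\<in>K. f p \<le> f p'"
    using continuous_attains_inf[OF _ K_ne f_cont] by blast
  then obtain z v where zv: "(z, v) \<in> K" "\<And>p'. p' \<in> K \<Longrightarrow> f (z, v) \<le> f p'"
    by (cases p) auto
  define d where "d = f (z, v)"
  have d: "0 \<le> d" by (simp add: d_def f_def infnorm_pos_le)
  \<comment> \<open>One step of the iteration: it moves \<open>z\<close> by exactly the residual
    \<open>d\<close> and then admits some \<open>w\<close> with residual at most
    \<open>L * h * d\<close>.\<close>
  define z' where "z' = x - h *\<^sub>R v"
  have zz': "infnorm (z' - z) = d"
    by (simp add: z'_def d_def f_def algebra_simps)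
  have "v \<in> F z" and r: "d + q * infnorm (z - m) \<le> r" using zv(1) by (auto simp: K_def d_def)
  from this(1) obtain w where w: "w \<in> F z'" "infnorm (v - w) \<le> L * d"
    using zz' infnorm_sub F_selection by metis
  have "x - z' - h *\<^sub>R w = h *\<^sub>R (v - w)" by (simp add: z'_def algebra_simps)
  then have "f (z', w) = h * infnorm (v - w)" using h_pos by (simp add: f_def infnorm_mul)
  also have "\<dots> \<le> h * (L * d)" using w(2) h_pos by (intro mult_left_mono) auto
  finally have fw: "f (z', w) \<le> (1 - q) * d" by (simp add: q_def mult_ac)
  \<comment> \<open>The saved residual \<open>q * d\<close> pays for the move:
    \<open>(1 - q) * d + q * (d + infnorm (z - m))\<close> equals
    \<open>d + q * infnorm (z - m)\<close>.\<close>
  have "q * infnorm (z' - m) \<le> q * (d + infnorm (z - m))"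
    using infnorm_triangle3[of z' m z] zz' q by (intro mult_left_mono) auto
  then have "(z', w) \<in> K" using w(1) fw r by (simp add: K_def algebra_simps)
  then have "d \<le> (1 - q) * d" using zv(2) fw d_def by fastforce
  then have "q * d \<le> 0" by (simp add: algebra_simps)
  then have "d = 0" using q d by (simp add: mult_le_0_iff)
  then have "x = z + h *\<^sub>R v" by (simp add: d_def f_def infnorm_eq_0 algebra_simps)
  then have "x \<in> G z" using \<open>v \<in> F z\<close> by (auto simp: euler_map_def)
  moreover have "infnorm (z - m) \<le> r / (1 - L * h)"
    using r q \<open>d = 0\<close> by (simp add: q_def field_simps)
  ultimately show thesis by (rule that)
qed

text \<open>Take the solution \<open>z\<close> nearest to \<open>m\<close>. Were \<open>x\<close>
  interior to \<open>G z\<close>, moving \<open>z\<close> a little towards \<open>m\<close> would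
  keep it a solution, against minimality.\<close>

lemma frontier_preimage_near:
  assumes x: "x \<in> max_nbhd r (G m)" "x \<notin> G m"
  obtains z where "x \<in> frontier (G z)" and "infnorm (z - m) \<le> r / (1 - L * h)"
proof -
  define Z where "Z = {z. x \<in> G z} \<inter> {z. infnorm (z - m) \<le> r / (1 - L * h)}"
  have "Z \<noteq> {}" using preimage_near[OF x(1)] by (auto simp: Z_def)
  moreover have "compact Z"
    unfolding Z_def by (intro closed_Int_compact closed_preimage_G compact_infnorm_cball)
  moreover have "continuous_on Z (\<lambda>z. infnorm (z - m))" by (intro continuous_intros)
  ultimately have "\<exists>z\<in>Z. \<forall>z'\<in>Z. infnorm (z - m) \<le> infnorm (z' - m)"
    by (intro continuous_attains_inf)
  then obtain z where z: "z \<in> Z" "\<And>z'. z' \<in> Z \<Longrightarrow> infnorm (z - m) \<le> infnorm (z' - m)"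
    by metis
  define D where "D = infnorm (z - m)"
  have "z \<noteq> m" using z(1) x(2) by (auto simp: Z_def)
  then have D: "0 < D" by (simp add: D_def infnorm_pos_lt)
  have "x \<notin> interior (G z)"
  proof
    assume "x \<in> interior (G z)"
    then obtain e where e: "0 < e" "cball x e \<subseteq> G z" by (meson mem_interior_cball)
    \<comment> \<open>The square root passes to the Euclidean norm. With the \<open>t\<close> below,
      the maximum-norm ball of radius \<open>(1 + L * h) * (t * D)\<close> about \<open>x\<close>
      fits into \<open>cball x e\<close>; this radius bounds the shift of \<open>G\<close> from
      \<open>z\<close> to \<open>z'\<close> and is then cancelled.\<close>
    define C where "C = sqrt DIM(real ^ 'n) * ((1 + L * h) * D)"
    have C: "0 < C" using D Lh_pos by (simp add: C_def add_pos_pos)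
    define t where "t = min 1 (e / C)"
    have t: "0 < t" "t \<le> 1" using e(1) C by (simp_all add: t_def)
    define z' where "z' = z + t *\<^sub>R (m - z)"
    have zz': "infnorm (z - z') = t * D"
      using t infnorm_sub[of m z] by (simp add: z'_def D_def infnorm_mul infnorm_neg)
    have "z' - m = (1 - t) *\<^sub>R (z - m)" by (simp add: z'_def algebra_simps)
    then have z'm: "infnorm (z' - m) = (1 - t) * D" using t by (simp add: infnorm_mul D_def)
    have "{w. infnorm (w - x) \<le> (1 + L * h) * (t * D)} \<subseteq> G z"
    proof
      fix w assume "w \<in> {w. infnorm (w - x) \<le> (1 + L * h) * (t * D)}"
      then have "norm (w - x) \<le> sqrt DIM(real ^ 'n) * ((1 + L * h) * (t * D))"
        by (intro order_trans[OF norm_le_infnorm] mult_left_mono) auto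
      also have "\<dots> = t * C" by (simp add: C_def mult_ac)
      also have "\<dots> \<le> e / C * C" using C by (intro mult_right_mono) (auto simp: t_def)
      also have "\<dots> = e" using C by simp
      finally show "w \<in> G z" using e(2) by (auto simp: dist_norm norm_minus_commute)
    qed
    also have "G z \<subseteq> max_nbhd ((1 + L * h) * (t * D) + 0) (G z')"
      using G_lipschitz[of z z'] zz' by simp
    finally have "x \<in> max_nbhd 0 (G z')"
      using t D Lh_pos by (intro infnorm_cball_cancel[OF convex_G compact_G]) auto
    then have "x \<in> G z'" using max_nbhd_zero[OF compact_G] by simp
    moreover have "(1 - t) * D < D" using t D by (simp add: algebra_simps)
    ultimately have "z' \<in> Z" using z(1) z'm by (auto simp: Z_def D_def)
    then show False using z(2)[of z'] z'm \<open>(1 - t) * D < D\<close> by (simp add: D_def)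
  qed
  then have "x \<in> frontier (G z)" using z(1) closure_subset by (auto simp: frontier_def Z_def)
  then show thesis using z(1) that by (simp add: Z_def)
qed

text \<open>Let \<open>D\<close> be the distance of the two solutions. Averaged selections at their
  midpoint miss \<open>x\<close> by at most \<open>L * h * D / 2 \<le> D / 8\<close>. The correction
  moves the midpoint by at most \<open>D / 8 / (3 / 4) = D / 6\<close>, and
  \<open>D / 2 + D / 6 = 2 / 3 * D\<close>.\<close>

lemma preimage_between:
  assumes "x \<in> G z1" "x \<in> G z2"
  obtains z where "x \<in> G z" "infnorm (z1 - z) \<le> 2 / 3 * infnorm (z1 - z2)"
    "infnorm (z - z2) \<le> 2 / 3 * infnorm (z1 - z2)"
proof -
  obtain v1 where v1: "v1 \<in> F z1" "x = z1 + h *\<^sub>R v1"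
    using assms by (auto simp: euler_map_def)
  obtain v2 where v2: "v2 \<in> F z2" "x = z2 + h *\<^sub>R v2"
    using assms by (auto simp: euler_map_def)
  define D where "D = infnorm (z1 - z2)"
  have D: "0 \<le> D" by (simp add: D_def infnorm_pos_le)
  define c where "c = (1 / 2) *\<^sub>R z1 + (1 / 2) *\<^sub>R z2"
  have "z1 - c = (1 / 2) *\<^sub>R (z1 - z2)" "c - z2 = (1 / 2) *\<^sub>R (z1 - z2)"
    by (simp_all add: c_def algebra_simps flip: scaleR_add_left)
  then have c: "infnorm (z1 - c) = D / 2" "infnorm (c - z2) = D / 2"
    by (simp_all add: infnorm_mul D_def)
  obtain w1 where w1: "w1 \<in> F c" "infnorm (v1 - w1) \<le> L * (D / 2)"
    using F_selection[OF v1(1), of c] c by metis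
  obtain w2 where w2: "w2 \<in> F c" "infnorm (v2 - w2) \<le> L * (D / 2)"
    using F_selection[OF v2(1), of c] c infnorm_sub by metis
  define g where "g = c + h *\<^sub>R ((1 / 2) *\<^sub>R w1 + (1 / 2) *\<^sub>R w2)"
  have "g \<in> G c"
    using convexD[OF F_convex w1(1) w2(1), of "1 / 2" "1 / 2"] by (auto simp: euler_map_def g_def)
  \<comment> \<open>Each half of \<open>x\<close> is replaced by one of its two representations, so
    that the midpoint cancels.\<close>
  have "x - g = (1 / 2) *\<^sub>R x + (1 / 2) *\<^sub>R x - g" by (simp flip: scaleR_add_left)
  also have "\<dots> = (1 / 2) *\<^sub>R (z1 + h *\<^sub>R v1) + (1 / 2) *\<^sub>R (z2 + h *\<^sub>R v2) - g"
    using v1(2) v2(2) by argo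
  also have "\<dots> = (h / 2) *\<^sub>R ((v1 - w1) + (v2 - w2))" by (simp add: g_def c_def algebra_simps)
  finally have "infnorm (x - g) = h / 2 * infnorm ((v1 - w1) + (v2 - w2))"
    using h_pos by (simp add: infnorm_mul)
  also have "\<dots> \<le> h / 2 * (L * (D / 2) + L * (D / 2))"
    using w1(2) w2(2) h_pos by (intro mult_left_mono order_trans[OF infnorm_triangle] add_mono) auto
  also have "\<dots> = L * h * (D / 2)" by (simp add: algebra_simps)
  also have "\<dots> \<le> 1 / 4 * (D / 2)" using Lh_le D by (intro mult_right_mono) auto
  finally have "x \<in> max_nbhd (D / 8) (G c)" using \<open>g \<in> G c\<close> by (intro max_nbhdI) auto
  then obtain z where z: "x \<in> G z" "infnorm (z - c) \<le> D / 8 / (1 - L * h)"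
    by (rule preimage_near)
  note z(2)
  also have "D / 8 / (1 - L * h) \<le> D / 8 / (3 / 4)"
    using Lh_le D by (intro divide_left_mono) auto
  finally have "infnorm (z - c) \<le> D / 6" by simp
  then have "infnorm (z1 - z) \<le> 2 / 3 * D" "infnorm (z - z2) \<le> 2 / 3 * D"
    using c infnorm_triangle3[of z1 z c] infnorm_triangle3[of z z2 c] infnorm_sub[of c z] by auto
  then show thesis using z(1) that by (simp add: D_def)
qed

text \<open>A discrete form of connectedness of the solution set \<open>{z. x \<in> G z}\<close>.\<close>

lemma preimage_chain_induct:
  assumes "x \<in> G z1" "x \<in> G z2" "P z1" and r: "0 < r"
    and step: "\<And>z z'. x \<in> G z \<Longrightarrow> x \<in> G z' \<Longrightarrow> infnorm (z - z') \<le> r \<Longrightarrow> P z \<Longrightarrow> P z'"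
  shows "P z2"
proof -
  \<comment> \<open>Each intermediate solution reduces the distance by the factor
    \<open>2 / 3\<close>, so \<open>n\<close> rounds of insertion give steps of at most
    \<open>r\<close>.\<close>
  have "infnorm (z1 - z2) \<le> r * (3 / 2) ^ n \<Longrightarrow> P z2" for n
    using assms(1-3)
  proof (induction n arbitrary: z1 z2)
    case 0
    then show ?case using step by simp
  next
    case (Suc n)
    obtain z where z: "x \<in> G z" "infnorm (z1 - z) \<le> 2 / 3 * infnorm (z1 - z2)"
      "infnorm (z - z2) \<le> 2 / 3 * infnorm (z1 - z2)"
      using preimage_between[OF Suc.prems(2,3)] .
    have "2 / 3 * infnorm (z1 - z2) \<le> r * (3 / 2) ^ n" using Suc.prems(1) by simp
    then have "infnorm (z1 - z) \<le> r * (3 / 2) ^ n" "infnorm (z - z2) \<le> r * (3 / 2) ^ n"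
      using z by auto
    then show ?case using Suc.IH Suc.prems z(1) by blast
  qed
  moreover obtain n where "infnorm (z1 - z2) / r < (3 / 2) ^ n"
    using real_arch_pow[of "3 / 2"] by auto
  ultimately show ?thesis using r by (simp add: field_simps) (metis less_imp_le mult.commute)
qed

lemma frontier_G_lipschitz:
  assumes "infnorm (x - y) \<le> r"
  shows "frontier (G x) \<subseteq> max_nbhd ((1 + L * h) * r) (frontier (G y))"
  using assms Lh_pos infnorm_pos_le[of "x - y"]
  by (intro frontier_subset_max_nbhd_frontier compact_G convex_G G_lipschitz) (auto simp: infnorm_sub)

end

subsection \<open>Grid layers\<close>

text \<open>The maximum norm is attained in one coordinate, and there the difference is an integer
  multiple of \<open>\<rho>\<close>.\<close>

lemma grid_infnorm_diff:
  fixes a b :: "real ^ 'n"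
  assumes "a \<in> grid \<rho>" "b \<in> grid \<rho>" "0 < \<rho>"
  obtains k :: nat where "infnorm (a - b) = \<rho> * real k"
proof -
  obtain i where i: "infnorm (a - b) = \<bar>(a - b) $ i\<bar>" using infnorm_attained by blast
  obtain k :: int where k: "a $ i = \<rho> * of_int k" using assms(1) by (auto simp: grid_def)
  obtain l :: int where l: "b $ i = \<rho> * of_int l" using assms(2) by (auto simp: grid_def)
  from k l have "infnorm (a - b) = \<bar>\<rho> * of_int (k - l)\<bar>" by (simp add: i algebra_simps)
  also have "\<dots> = \<rho> * real (nat \<bar>k - l\<bar>)" using assms(3) by (simp add: abs_mult)
  finally show thesis by (rule that)
qed

text \<open>Grid distances are multiples of \<open>\<rho>\<close>, so a strict bound rounds down to
  the previous multiple. This turns metric estimates into numbers of layers.\<close>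

lemma grid_infnorm_le:
  assumes "a \<in> grid \<rho>" "b \<in> grid \<rho>" "0 < \<rho>" and "infnorm (a - b) < (real k + 1) * \<rho>"
  shows "infnorm (a - b) \<le> real k * \<rho>"
proof -
  obtain l :: nat where l: "infnorm (a - b) = \<rho> * real l"
    using grid_infnorm_diff[OF assms(1-3)] .
  then have "real l < real k + 1" using assms(3,4) by (simp add: mult.commute[of \<rho>])
  then have "l \<le> k" by simp
  then show ?thesis using l assms(3) by simp
qed

lemma grid_infnorm_ge:
  assumes "a \<in> grid \<rho>" "b \<in> grid \<rho>" "0 < \<rho>" and "a \<noteq> b"
  shows "\<rho> \<le> infnorm (a - b)"
proof (rule ccontr)
  assume "\<not> ?thesis"
  then have "infnorm (a - b) \<le> 0" using grid_infnorm_le[OF assms(1-3), of 0] by simp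
  then show False using assms(4) infnorm_pos_lt[of "a - b"] by simp
qed

lemma grid_round:
  fixes z :: "real ^ 'n"
  assumes "0 < \<rho>"
  obtains z' where "z' \<in> grid \<rho>" "infnorm (z - z') \<le> \<rho> / 2"
proof
  let ?z = "(\<chi> i. \<rho> * of_int (round (z $ i / \<rho>))) :: real ^ 'n"
  show "?z \<in> grid \<rho>" by (auto simp: grid_def)
  have "\<bar>z $ i - \<rho> * of_int (round (z $ i / \<rho>))\<bar> \<le> \<rho> / 2" for i
  proof -
    have "z $ i - \<rho> * of_int (round (z $ i / \<rho>)) = - \<rho> * (of_int (round (z $ i / \<rho>)) - z $ i / \<rho>)"
      using assms by (simp add: field_simps)
    then have "\<bar>z $ i - \<rho> * of_int (round (z $ i / \<rho>))\<bar>
        = \<rho> * \<bar>of_int (round (z $ i / \<rho>)) - z $ i / \<rho>\<bar>"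
      using assms by (simp only: abs_mult abs_minus abs_of_pos)
    also have "\<dots> \<le> \<rho> * (1 / 2)"
      using assms of_int_round_abs_le[of "z $ i / \<rho>"] by (intro mult_left_mono) auto
    finally show ?thesis by simp
  qed
  then show "infnorm (z - ?z) \<le> \<rho> / 2" by (simp add: infnorm_le_iff del: le_divide_eq_numeral1)
qed

lemma grid_midpoint:
  fixes a b :: "real ^ 'n"
  assumes ab: "a \<in> grid \<rho>" "b \<in> grid \<rho>" and \<rho>: "0 < \<rho>" and "infnorm (a - b) \<le> 2 * \<rho>"
  obtains c where "c \<in> grid \<rho>" "infnorm (a - c) \<le> \<rho>" "infnorm (c - b) \<le> \<rho>"
proof -
  obtain k where k: "\<And>i. a $ i = \<rho> * of_int (k i)" using ab(1) unfolding grid_def by simp metis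
  obtain l where l: "\<And>i. b $ i = \<rho> * of_int (l i)" using ab(2) unfolding grid_def by simp metis
  \<comment> \<open>\<open>div\<close> rounds down; for integers at most \<open>2\<close> apart, the
    result is within \<open>1\<close> of both, also if their sum is odd.\<close>
  let ?c = "(\<chi> i. \<rho> * of_int ((k i + l i) div 2)) :: real ^ 'n"
  have scale: "\<bar>\<rho> * of_int p - \<rho> * of_int q\<bar> \<le> \<rho> * of_int n \<longleftrightarrow> \<bar>p - q\<bar> \<le> n" for p q n :: int
  proof -
    have "\<bar>\<rho> * of_int p - \<rho> * of_int q\<bar> = \<rho> * of_int \<bar>p - q\<bar>"
      using \<rho> by (simp add: abs_mult flip: right_diff_distrib)
    then show ?thesis using \<rho> by (simp only: mult_le_cancel_left_pos of_int_le_iff)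
  qed
  have kl: "\<bar>k i - l i\<bar> \<le> 2" for i
    using assms(4) scale[of "k i" "l i" 2] by (auto simp: infnorm_le_iff k l mult.commute)
  have "\<bar>k i - (k i + l i) div 2\<bar> \<le> 1" "\<bar>(k i + l i) div 2 - l i\<bar> \<le> 1" for i
    using kl[of i] by linarith+
  then have "infnorm (a - ?c) \<le> \<rho>" "infnorm (?c - b) \<le> \<rho>"
    using scale[of _ _ 1] by (auto simp: infnorm_le_iff k l)
  moreover have "?c \<in> grid \<rho>" by (auto simp: grid_def)
  ultimately show thesis by (rule that[rotated])
qed

text \<open>\<open>B\<close> may be infinite, but the distances are natural multiples of
  \<open>\<rho>\<close> and hence have a least element.\<close>

lemma max_dist_grid_attained:
  assumes x: "x \<in> grid \<rho>" and B: "B \<subseteq> grid \<rho>" "B \<noteq> {}" and \<rho>: "0 < \<rho>"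
  obtains b where "b \<in> B" "\<And>b'. b' \<in> B \<Longrightarrow> infnorm (x - b) \<le> infnorm (x - b')"
    "max_dist x B = ereal (infnorm (x - b))"
proof -
  have "\<forall>b\<in>B. \<exists>k :: nat. infnorm (x - b) = \<rho> * real k"
    using grid_infnorm_diff[OF x _ \<rho>] B(1) by (meson subsetD)
  then obtain k :: "_ \<Rightarrow> nat" where k: "\<And>b. b \<in> B \<Longrightarrow> infnorm (x - b) = \<rho> * real (k b)"
    by metis
  obtain b0 where "b0 \<in> B" using B(2) by blast
  then have "\<exists>b. b \<in> B \<and> (\<forall>b'. b' \<in> B \<longrightarrow> k b \<le> k b')" by (rule ex_has_least_nat)
  then obtain b where b: "b \<in> B" "\<And>b'. b' \<in> B \<Longrightarrow> k b \<le> k b'" by metis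
  then have le: "infnorm (x - b) \<le> infnorm (x - b')" if "b' \<in> B" for b'
    using that k \<rho> by simp
  moreover have "max_dist x B = ereal (infnorm (x - b))"
    unfolding max_dist_def using b(1) le by (intro antisym INF_lower INF_greatest) auto
  ultimately show thesis using b(1) that by blast
qed

lemma max_dist_grid_eq_iff:
  assumes "x \<in> grid \<rho>" "B \<subseteq> grid \<rho>" "0 < \<rho>"
  shows "max_dist x B = ereal r \<longleftrightarrow>
    (\<exists>b\<in>B. infnorm (x - b) = r) \<and> (\<forall>b\<in>B. r \<le> infnorm (x - b))"
proof (cases "B = {}")
  case True
  then show ?thesis by (simp add: max_dist_def top_ereal_def)
next
  case False
  obtain b where "b \<in> B" "\<And>b'. b' \<in> B \<Longrightarrow> infnorm (x - b) \<le> infnorm (x - b')"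
    "max_dist x B = ereal (infnorm (x - b))"
    using max_dist_grid_attained[OF assms(1,2) False assms(3)] by metis
  then show ?thesis by (auto intro: antisym)
qed

lemma grid_boundary_0_iff:
  "a \<in> grid_boundary \<rho> 0 A \<longleftrightarrow> a \<in> A \<and> a \<in> grid \<rho> \<and> (\<exists>x\<in>grid \<rho> - A. infnorm (x - a) = \<rho>)"
  by (auto simp: grid_boundary_def grid_boundary0_def)

lemma grid_boundary_pos_iff:
  assumes "0 < \<rho>" "0 < k"
  shows "x \<in> grid_boundary \<rho> k A \<longleftrightarrow> x \<in> grid \<rho> \<and> x \<notin> A \<and>
    (\<exists>a\<in>grid_boundary \<rho> 0 A. infnorm (x - a) = of_int k * \<rho>) \<and>
    (\<forall>a\<in>grid_boundary \<rho> 0 A. of_int k * \<rho> \<le> infnorm (x - a))"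
proof -
  have "grid_boundary \<rho> 0 A \<subseteq> grid \<rho>" by (auto simp: grid_boundary_0_iff)
  from max_dist_grid_eq_iff[OF _ this assms(1)] show ?thesis
    using assms(2) by (auto simp: grid_boundary_def)
qed

text \<open>A neighbour \<open>a\<close> of \<open>x\<close> in \<open>A\<close> is itself in layer
  \<open>0\<close>, with \<open>x\<close> as witness, and distinct grid points are at least
  \<open>\<rho>\<close> apart.\<close>

lemma grid_boundary_1_iff:
  assumes "0 < \<rho>"
  shows "x \<in> grid_boundary \<rho> 1 A \<longleftrightarrow>
    x \<in> grid \<rho> \<and> x \<notin> A \<and> (\<exists>a\<in>A \<inter> grid \<rho>. infnorm (x - a) = \<rho>)"
proof
  assume "x \<in> grid_boundary \<rho> 1 A"
  then show "x \<in> grid \<rho> \<and> x \<notin> A \<and> (\<exists>a\<in>A \<inter> grid \<rho>. infnorm (x - a) = \<rho>)"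
    using assms by (auto simp: grid_boundary_pos_iff grid_boundary_0_iff)
next
  assume x: "x \<in> grid \<rho> \<and> x \<notin> A \<and> (\<exists>a\<in>A \<inter> grid \<rho>. infnorm (x - a) = \<rho>)"
  then obtain a where "a \<in> A" "a \<in> grid \<rho>" "infnorm (x - a) = \<rho>" by blast
  then have "\<exists>a\<in>grid_boundary \<rho> 0 A. infnorm (x - a) = 1 * \<rho>"
    using x by (intro bexI[of _ a]) (auto simp: grid_boundary_0_iff)
  moreover have "1 * \<rho> \<le> infnorm (x - a)" if "a \<in> grid_boundary \<rho> 0 A" for a
    using that x assms grid_infnorm_ge[of x \<rho> a] unfolding grid_boundary_0_iff by auto
  ultimately show "x \<in> grid_boundary \<rho> 1 A"
    using x assms unfolding grid_boundary_pos_iff[OF assms zero_less_one] of_int_1 by blast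
qed

lemma grid_boundary_minus_1_iff:
  assumes "0 < \<rho>"
  shows "a \<in> grid_boundary \<rho> (- 1) A \<longleftrightarrow> a \<in> A \<and> a \<in> grid \<rho> \<and> a \<notin> grid_boundary \<rho> 0 A \<and>
    (\<exists>b\<in>grid_boundary \<rho> 0 A. infnorm (a - b) = \<rho>)"
proof -
  have sub: "grid_boundary \<rho> 0 A \<subseteq> grid \<rho>" by (auto simp: grid_boundary_0_iff)
  have "a \<in> grid_boundary \<rho> (- 1) A \<longleftrightarrow> a \<in> A \<and> a \<in> grid \<rho> \<and>
      max_dist a (grid_boundary \<rho> 0 A) = ereal \<rho>"
    by (auto simp: grid_boundary_def)
  also have "\<dots> \<longleftrightarrow> a \<in> A \<and> a \<in> grid \<rho> \<and> (\<exists>b\<in>grid_boundary \<rho> 0 A. infnorm (a - b) = \<rho>) \<and>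
      (\<forall>b\<in>grid_boundary \<rho> 0 A. \<rho> \<le> infnorm (a - b))"
    using max_dist_grid_eq_iff[OF _ sub assms] by blast
  also have "\<dots> \<longleftrightarrow> a \<in> A \<and> a \<in> grid \<rho> \<and> a \<notin> grid_boundary \<rho> 0 A \<and>
    (\<exists>b\<in>grid_boundary \<rho> 0 A. infnorm (a - b) = \<rho>)"
    using grid_infnorm_ge[OF _ _ assms] sub assms by (force simp: infnorm_0)
  finally show ?thesis .
qed

lemma grid_boundary_12D:
  assumes "0 < \<rho>" "x \<in> grid_boundary \<rho> 1 A \<union> grid_boundary \<rho> 2 A"
  shows "x \<in> grid \<rho>" "x \<notin> A" "\<exists>a\<in>grid_boundary \<rho> 0 A. infnorm (x - a) \<le> 2 * \<rho>"
proof -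
  show "x \<in> grid \<rho>" "x \<notin> A" using assms by (auto simp: grid_boundary_pos_iff)
  obtain a where "a \<in> grid_boundary \<rho> 0 A" "infnorm (x - a) = \<rho> \<or> infnorm (x - a) = 2 * \<rho>"
    using assms by (force simp: grid_boundary_pos_iff)
  then show "\<exists>a\<in>grid_boundary \<rho> 0 A. infnorm (x - a) \<le> 2 * \<rho>"
    using assms(1) by (intro bexI[of _ a]) auto
qed

text \<open>Take a grid midpoint \<open>c\<close> of \<open>x\<close> and \<open>a\<close>. If
  \<open>x\<close> is not in layer \<open>1\<close>, then \<open>c\<close> lies outside
  \<open>A\<close> and certifies that \<open>a\<close> is in layer \<open>0\<close>.\<close>

lemma grid_boundary_12I:
  assumes \<rho>: "0 < \<rho>" and x: "x \<in> grid \<rho>" "x \<notin> A" and a: "a \<in> A" "a \<in> grid \<rho>"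
    and xa: "infnorm (x - a) \<le> 2 * \<rho>"
  shows "x \<in> grid_boundary \<rho> 1 A \<union> grid_boundary \<rho> 2 A"
proof -
  obtain c where c: "c \<in> grid \<rho>" "infnorm (x - c) \<le> \<rho>" "infnorm (c - a) \<le> \<rho>"
    using grid_midpoint[OF x(1) a(2) \<rho> xa] .
  show ?thesis
  proof (cases "x \<in> grid_boundary \<rho> 1 A")
    case False
    then have no: "\<rho> < infnorm (x - b)" if "b \<in> A" "b \<in> grid \<rho>" for b
      using that x grid_infnorm_ge[OF x(1) that(2) \<rho>] \<rho>
      by (auto simp: grid_boundary_1_iff order_less_le)
    then have "c \<notin> A" using c by force
    then have "infnorm (c - a) = \<rho>" using c a grid_infnorm_ge[OF c(1) a(2) \<rho>] by force
    then have a0: "a \<in> grid_boundary \<rho> 0 A"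
      using a c(1) \<open>c \<notin> A\<close> by (auto simp: grid_boundary_0_iff)
    have two: "2 * \<rho> \<le> infnorm (x - b)" if "b \<in> grid_boundary \<rho> 0 A" for b
    proof -
      have b: "b \<in> A" "b \<in> grid \<rho>" using that by (auto simp: grid_boundary_0_iff)
      show ?thesis using no[OF b] grid_infnorm_le[OF x(1) b(2) \<rho>, of 1] by force
    qed
    then have "infnorm (x - a) = 2 * \<rho>" using xa a0 by (force intro: antisym)
    then have "x \<in> grid_boundary \<rho> 2 A"
      using x a0 two \<rho> by (auto simp: grid_boundary_pos_iff)
    then show ?thesis by simp
  qed simp
qed

subsection \<open>The boundary Euler scheme\<close>

locale boundary_euler = lipschitz_euler F L h
  for F :: "real ^ 'n \<Rightarrow> (real ^ 'n) set" and L h :: real +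
  fixes \<Phi> \<Phi>bd :: "real ^ 'n \<Rightarrow> (real ^ 'n) set"
    and \<rho> \<alpha> \<beta> :: real
    and M :: "(real ^ 'n) set"
  assumes rho_pos: "0 < \<rho>"
    and alpha_eq: "\<alpha> = (1 + L * h) * \<rho> / 2"
    and beta_nonneg: "0 \<le> \<beta>"
    and beta_less: "\<beta> < (1 - 3 * L * h) * \<rho>" "\<beta> < (1 - L * h) * \<rho> / 2"
    and Phi_lower: "blown_euler_map F h \<alpha> x \<subseteq> \<Phi> x"
    and Phi_upper: "\<Phi> x \<subseteq> max_nbhd \<beta> (blown_euler_map F h \<alpha> x)"
    and Phi_bd_lower: "blown_boundary_euler_map F h \<alpha> x \<subseteq> \<Phi>bd x"
    and Phi_bd_upper: "\<Phi>bd x \<subseteq> max_nbhd \<beta> (blown_boundary_euler_map F h \<alpha> x)"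
    and M_grid: "M \<subseteq> grid \<rho>"
begin

abbreviation M' :: "(real ^ 'n) set"
  where "M' \<equiv> \<Union>x\<in>M. \<Phi> x"

lemma alpha_pos: "0 < \<alpha>"
  using rho_pos Lh_pos by (simp add: alpha_eq)

text \<open>The second bound on \<open>\<beta>\<close> complements \<open>\<alpha>\<close>:
  \<open>(1 + L * h) / 2 + (1 - L * h) / 2 = 1\<close>.\<close>

lemma alpha_beta_less: "\<alpha> + \<beta> < \<rho>"
  using beta_less(2) by (simp add: alpha_eq field_simps)

text \<open>Adding the rounding error \<open>\<rho> / 2\<close> keeps the total below
  \<open>2 * \<rho>\<close>, which means at most one grid step.\<close>

lemma alpha_beta_divide_less: "(\<alpha> + \<beta>) / (1 - L * h) < 3 / 2 * \<rho>"
proof -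
  have "\<alpha> + \<beta> < (1 + L * h) * \<rho> / 2 + (1 - 3 * L * h) * \<rho>"
    using beta_less(1) by (simp add: alpha_eq)
  also have "\<dots> = 3 / 2 * \<rho> * (1 - L * h) - L * h * \<rho>" by (simp add: algebra_simps)
  finally have "\<alpha> + \<beta> < 3 / 2 * \<rho> * (1 - L * h)"
    using mult_pos_pos[OF Lh_pos rho_pos] by linarith
  then show ?thesis using Lh_le by (simp add: divide_less_eq)
qed

text \<open>The first bound on \<open>\<beta>\<close> fits exactly:
  \<open>(1 + L * h) / 2 + (1 - 3 * L * h) + 1 = 5 / 2 * (1 - L * h)\<close>. After rounding the
  total is below \<open>3 * \<rho>\<close>, so two outer layers suffice in
  \<open>S1\<close>.\<close>

lemma rho_alpha_beta_divide_less: "(\<alpha> + \<beta> + \<rho>) / (1 - L * h) < 5 / 2 * \<rho>"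
proof -
  have "\<alpha> + \<beta> + \<rho> < (1 + L * h) * \<rho> / 2 + (1 - 3 * L * h) * \<rho> + \<rho>"
    using beta_less(1) by (simp add: alpha_eq)
  also have "\<dots> = 5 / 2 * \<rho> * (1 - L * h)" by (simp add: algebra_simps)
  finally show ?thesis using Lh_le by (simp add: divide_less_eq)
qed

lemma frontier_G_subset: "frontier (G x) \<subseteq> G x"
  by (rule frontier_subset_compact[OF compact_G])

lemma Phi_near: "\<Phi> x \<subseteq> max_nbhd (\<alpha> + \<beta>) (G x)"
  using Phi_upper[of x] max_nbhd_trans[of "blown_euler_map F h \<alpha> x" \<alpha> "G x" \<beta>]
  by (auto simp: blown_euler_map_def add.commute)

lemma Phi_bd_near: "\<Phi>bd x \<subseteq> max_nbhd (\<alpha> + \<beta>) (frontier (G x))"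
  using Phi_bd_upper[of x]
    max_nbhd_trans[of "blown_boundary_euler_map F h \<alpha> x" \<alpha> "frontier (G x)" \<beta>]
  by (auto simp: blown_boundary_euler_map_def add.commute)

lemma max_nbhd_subset_Phi: "max_nbhd \<alpha> (G x) \<subseteq> \<Phi> x"
  using Phi_lower by (simp add: blown_euler_map_def)

lemma max_nbhd_subset_Phi_bd: "max_nbhd \<alpha> (frontier (G x)) \<subseteq> \<Phi>bd x"
  using Phi_bd_lower by (simp add: blown_boundary_euler_map_def)

text \<open>\<open>\<alpha>\<close> is exactly the shift of \<open>G\<close> that rounding to the
  grid can cause, so a rounded solution still produces the point.\<close>

lemma G_subset_max_nbhd:
  assumes "infnorm (z - z') \<le> \<rho> / 2"
  shows "G z \<subseteq> max_nbhd \<alpha> (G z')" "frontier (G z) \<subseteq> max_nbhd \<alpha> (frontier (G z'))"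
  using G_lipschitz[OF assms] frontier_G_lipschitz[OF assms] by (simp_all add: alpha_eq)

lemma grid_preimage_near:
  assumes y: "y \<in> max_nbhd (\<alpha> + \<beta>) (G m)" and m: "m \<in> grid \<rho>"
  obtains z z' where "y \<in> G z" "z' \<in> grid \<rho>" "infnorm (z - z') \<le> \<rho> / 2" "infnorm (z' - m) \<le> \<rho>"
proof -
  obtain z where z: "y \<in> G z" "infnorm (z - m) \<le> (\<alpha> + \<beta>) / (1 - L * h)"
    using preimage_near[OF y] .
  obtain z' where z': "z' \<in> grid \<rho>" "infnorm (z - z') \<le> \<rho> / 2" using grid_round[OF rho_pos] .
  have "infnorm (z' - m) < 2 * \<rho>"
    using z(2) z'(2) alpha_beta_divide_less infnorm_triangle3[of z' m z] infnorm_sub[of z' z]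
    by linarith
  then have "infnorm (z' - m) \<le> \<rho>" using grid_infnorm_le[OF z'(1) m rho_pos, of 1] by simp
  then show thesis using z(1) z' that by blast
qed

text \<open>Solve for \<open>x\<close> on the frontier and round. The rounded point produces
  \<open>x\<close> under both maps, and \<open>x \<notin> M'\<close> then expels it from
  \<open>M\<close>.\<close>

lemma outer_frontier_preimage:
  assumes x: "x \<notin> M'" and m: "m \<in> M" and a: "a \<in> \<Phi> m" and xa: "infnorm (x - a) \<le> \<rho>"
  obtains z where "z \<in> grid \<rho>" "z \<notin> M" "x \<in> \<Phi>bd z" "infnorm (z - m) \<le> 2 * \<rho>"
proof -
  have "x \<in> max_nbhd (\<alpha> + \<beta> + \<rho>) (G m)" using a Phi_near xa by (blast intro: max_nbhd_add)
  moreover have "x \<notin> G m"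
    using x m max_nbhd_subset_Phi[of m] G_subset_max_nbhd(1)[of m m] rho_pos
    by (auto simp: infnorm_0)
  ultimately obtain z where z: "x \<in> frontier (G z)" "infnorm (z - m) \<le> (\<alpha> + \<beta> + \<rho>) / (1 - L * h)"
    by (rule frontier_preimage_near)
  obtain z' where z': "z' \<in> grid \<rho>" "infnorm (z - z') \<le> \<rho> / 2" using grid_round[OF rho_pos] .
  have "infnorm (z' - m) < 3 * \<rho>"
    using z(2) z'(2) rho_alpha_beta_divide_less infnorm_triangle3[of z' m z] infnorm_sub[of z' z]
    by linarith
  then have "infnorm (z' - m) \<le> 2 * \<rho>"
    using grid_infnorm_le[of z' \<rho> m 2] z'(1) m M_grid rho_pos by auto
  moreover have "x \<in> \<Phi> z'"
    using z(1) frontier_G_subset G_subset_max_nbhd(1)[OF z'(2)] max_nbhd_subset_Phi by blast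
  then have "z' \<notin> M" using x by blast
  moreover have "x \<in> \<Phi>bd z'"
    using z(1) G_subset_max_nbhd(2)[OF z'(2)] max_nbhd_subset_Phi_bd by blast
  ultimately show thesis using z'(1) that by blast
qed

lemma neighbour_in_M:
  assumes "m \<in> M" "m \<notin> grid_boundary \<rho> 0 M" "z \<in> grid \<rho>" "infnorm (z - m) \<le> \<rho>"
  shows "z \<in> M"
proof (rule ccontr)
  assume "z \<notin> M"
  moreover have m: "m \<in> grid \<rho>" using assms(1) M_grid by blast
  ultimately have "infnorm (z - m) = \<rho>"
    using assms grid_infnorm_ge[OF assms(3) m rho_pos] by force
  then show False using assms m \<open>z \<notin> M\<close> by (auto simp: grid_boundary_0_iff)
qed

text \<open>\<open>\<Phi>bd m\<close> may overshoot \<open>\<Phi> m\<close>. An exact solution, once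
  rounded, is at most one grid step from \<open>m\<close> and lies in \<open>M\<close> because
  \<open>m\<close> is not in layer \<open>0\<close>.\<close>

lemma Phi_bd_minus_1_subset:
  assumes "m \<in> grid_boundary \<rho> (- 1) M"
  shows "\<Phi>bd m \<subseteq> M'"
proof
  fix y assume "y \<in> \<Phi>bd m"
  then have "y \<in> max_nbhd (\<alpha> + \<beta>) (G m)"
    using Phi_bd_near max_nbhd_mono[OF frontier_G_subset order_refl] by blast
  moreover have m: "m \<in> M" "m \<in> grid \<rho>" "m \<notin> grid_boundary \<rho> 0 M"
    using assms by (auto simp: grid_boundary_minus_1_iff[OF rho_pos])
  ultimately obtain z z' where z: "y \<in> G z" "z' \<in> grid \<rho>" "infnorm (z - z') \<le> \<rho> / 2"
    "infnorm (z' - m) \<le> \<rho>"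
    using grid_preimage_near by metis
  have "z' \<in> M" using neighbour_in_M[OF m(1,3) z(2,4)] .
  moreover have "y \<in> \<Phi> z'" using z(1) G_subset_max_nbhd(1)[OF z(3)] max_nbhd_subset_Phi by blast
  ultimately show "y \<in> M'" by blast
qed

text \<open>\<open>a\<close> comes from some \<open>m\<close> in \<open>M\<close> off layer
  \<open>0\<close>, and its outer neighbour from some \<open>c\<close> outside \<open>M\<close>
  within \<open>2 * \<rho>\<close> of \<open>m\<close>. A grid midpoint \<open>b\<close> is in layer
  \<open>0\<close>, so \<open>m\<close> is in layer \<open>-1\<close>; as \<open>b\<close> does not
  produce \<open>a\<close>, the frontier of \<open>G m\<close> must be near.\<close>

lemma grid_boundary_0_image_cases:
  assumes a: "a \<in> grid_boundary \<rho> 0 M'"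
    and no: "\<And>m. m \<in> grid_boundary \<rho> 0 M \<Longrightarrow> a \<notin> \<Phi> m"
  obtains m where "m \<in> grid_boundary \<rho> (- 1) M" "a \<in> \<Phi>bd m"
proof -
  obtain x where x: "x \<in> grid \<rho>" "x \<notin> M'" "infnorm (x - a) = \<rho>"
    using a by (auto simp: grid_boundary_0_iff)
  obtain m0 where m0: "m0 \<in> M" "a \<in> \<Phi> m0" using a by (auto simp: grid_boundary_0_iff)
  \<comment> \<open>\<open>m0\<close> only gives the radius \<open>\<alpha> + \<beta>\<close>; the
    rounded solution \<open>m\<close> gives the radius \<open>\<alpha>\<close> that the lower bound
    on \<open>\<Phi>bd\<close> requires.\<close>
  then obtain z m where z: "a \<in> G z" "m \<in> grid \<rho>" "infnorm (z - m) \<le> \<rho> / 2"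
    "infnorm (m - m0) \<le> \<rho>"
    using grid_preimage_near[of a m0] Phi_near M_grid by blast
  have am: "a \<in> max_nbhd \<alpha> (G m)" using z(1) G_subset_max_nbhd(1)[OF z(3)] by blast
  then have a\<Phi>: "a \<in> \<Phi> m" using max_nbhd_subset_Phi by blast
  have m: "m \<in> M" using neighbour_in_M[OF m0(1) _ z(2,4)] no m0 by blast
  have m_int: "m \<notin> grid_boundary \<rho> 0 M" using no a\<Phi> by blast
  obtain c where c: "c \<in> grid \<rho>" "c \<notin> M" "infnorm (c - m) \<le> 2 * \<rho>"
    using outer_frontier_preimage[OF x(2) m a\<Phi>] x(3) by auto
  obtain b where b: "b \<in> grid \<rho>" "infnorm (c - b) \<le> \<rho>" "infnorm (b - m) \<le> \<rho>"
    using grid_midpoint[OF c(1) z(2) rho_pos c(3)] .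
  have bM: "b \<in> M" using neighbour_in_M[OF m m_int b(1,3)] .
  then have b0: "b \<in> grid_boundary \<rho> 0 M" using neighbour_in_M[OF _ _ c(1) b(2)] c(2) by blast
  then have "infnorm (m - b) = \<rho>"
    using m_int b(3) grid_infnorm_ge[OF z(2) b(1) rho_pos] by (force simp: infnorm_sub)
  then have "m \<in> grid_boundary \<rho> (- 1) M"
    using m z(2) m_int b0 by (auto simp: grid_boundary_minus_1_iff[OF rho_pos])
  \<comment> \<open>\<open>(1 + L * h) * \<rho> = \<alpha> + \<alpha>\<close>, so
    \<open>frontier_near\<close> applies with \<open>r = t = \<alpha>\<close>.\<close>
  moreover have "G m \<subseteq> max_nbhd (\<alpha> + \<alpha>) (G b)"
    using G_lipschitz[of m b \<rho>] \<open>infnorm (m - b) = \<rho>\<close> by (simp add: alpha_eq mult.commute)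
  then have "a \<in> max_nbhd \<alpha> (frontier (G m))"
    using am no[OF b0] max_nbhd_subset_Phi alpha_pos
    by (intro frontier_near[OF _ compact_G convex_G compact_G convex_G]) auto
  then have "a \<in> \<Phi>bd m" using max_nbhd_subset_Phi_bd by blast
  ultimately show thesis by (rule that)
qed

text \<open>An outer neighbour of \<open>a\<close> is outside \<open>G m\<close>, while a point of
  \<open>G m\<close> is within \<open>\<alpha> + \<beta> < \<rho>\<close> of \<open>a\<close>; the
  frontier passes between them.\<close>

lemma grid_boundary_0_image_frontier:
  assumes a: "a \<in> grid_boundary \<rho> 0 M'" and m: "m \<in> M" "a \<in> \<Phi> m"
  shows "a \<in> max_nbhd \<rho> (\<Phi>bd m)"
proof -
  obtain x where x: "x \<notin> M'" "infnorm (x - a) = \<rho>"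
    using a by (auto simp: grid_boundary_0_iff)
  obtain g where g: "g \<in> G m" "infnorm (a - g) \<le> \<alpha> + \<beta>"
    using m(2) Phi_near max_nbhd_compactE[OF _ compact_G] by blast
  have "x \<notin> G m"
    using x(1) m max_nbhd_subset_Phi[of m] G_subset_max_nbhd(1)[of m m] rho_pos
    by (auto simp: infnorm_0)
  then have "a \<in> max_nbhd \<rho> (frontier (G m))"
    using frontier_between[OF g(1), of x a \<rho>] x(2) g(2) alpha_beta_less infnorm_sub[of a g] by simp
  moreover have "frontier (G m) \<subseteq> \<Phi>bd m"
    using G_subset_max_nbhd(2)[of m m] max_nbhd_subset_Phi_bd rho_pos by (force simp: infnorm_0)
  ultimately show ?thesis using max_nbhd_mono[OF _ order_refl] by blast
qed

text \<open>The grid points near the solution set \<open>{z. x \<in> G z}\<close> form a chain from \<open>M\<close> to the layer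
  around \<open>c\<close> that cannot leave \<open>M\<close> without passing through the boundary of \<open>M\<close>.\<close>

lemma Phi_bd_outer_cases:
  assumes x: "x \<in> \<Phi>bd c" and c: "c \<in> grid \<rho>" "c \<notin> M" and xM: "x \<in> M'"
  shows "\<exists>m\<in>grid_boundary \<rho> 0 M. x \<in> \<Phi> m"
proof (rule ccontr)
  assume no: "\<not> (\<exists>m\<in>grid_boundary \<rho> 0 M. x \<in> \<Phi> m)"
  have near: "x \<in> \<Phi> z'" if "x \<in> G z" "infnorm (z - z') \<le> \<rho> / 2" for z z'
    using that G_subset_max_nbhd(1) max_nbhd_subset_Phi by blast
  \<comment> \<open>By \<open>no\<close>, a point of \<open>M\<close> that produces \<open>x\<close>
    is off layer \<open>0\<close>, so a single grid step from it cannot leave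
    \<open>M\<close>.\<close>
  have move: "z2 \<in> M" if "z1 \<in> M" "x \<in> \<Phi> z1" "z2 \<in> grid \<rho>" "infnorm (z2 - z1) \<le> \<rho>" for z1 z2
    using neighbour_in_M[OF that(1) _ that(3,4)] no that(2) by blast
  obtain m where m: "m \<in> M" "x \<in> \<Phi> m" using xM by blast
  then obtain z1 z1' where z1: "x \<in> G z1" "z1' \<in> grid \<rho>" "infnorm (z1 - z1') \<le> \<rho> / 2"
    "infnorm (z1' - m) \<le> \<rho>"
    using grid_preimage_near[of x m] Phi_near M_grid by blast
  have "x \<in> max_nbhd (\<alpha> + \<beta>) (G c)"
    using x Phi_bd_near max_nbhd_mono[OF frontier_G_subset order_refl] by blast
  then obtain z2 z2' where z2: "x \<in> G z2" "z2' \<in> grid \<rho>" "infnorm (z2 - z2') \<le> \<rho> / 2"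
    "infnorm (z2' - c) \<le> \<rho>"
    using grid_preimage_near[OF _ c(1)] by metis
  have "\<exists>z'\<in>M. infnorm (z2 - z') \<le> \<rho> / 2"
  proof (rule preimage_chain_induct[OF z1(1) z2(1)])
    show "\<exists>z'\<in>M. infnorm (z1 - z') \<le> \<rho> / 2"
      using move[OF m z1(2,4)] z1(3) by blast
    show "0 < \<rho> / 2" using rho_pos by simp
  next
    fix z w assume zw: "x \<in> G z" "x \<in> G w" "infnorm (z - w) \<le> \<rho> / 2"
      and "\<exists>z'\<in>M. infnorm (z - z') \<le> \<rho> / 2"
    then obtain z' where z': "z' \<in> M" "infnorm (z - z') \<le> \<rho> / 2" by blast
    obtain w' where w': "w' \<in> grid \<rho>" "infnorm (w - w') \<le> \<rho> / 2" using grid_round[OF rho_pos] .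
    \<comment> \<open>Three errors of \<open>\<rho> / 2\<close> stay below
      \<open>2 * \<rho>\<close>, so the two rounded points are at most one grid step apart.\<close>
    have "infnorm (w' - z') < (real 1 + 1) * \<rho>"
      using zw(3) z'(2) w'(2) infnorm_triangle3[of w' z' w] infnorm_triangle3[of w z' z]
        infnorm_sub[of w w'] infnorm_sub[of z w] rho_pos by simp
    then have "infnorm (w' - z') \<le> \<rho>"
      using grid_infnorm_le[OF w'(1) _ rho_pos, of z' 1] z'(1) M_grid by auto
    then have "w' \<in> M" using move[OF z'(1) near[OF zw(1) z'(2)] w'(1)] by blast
    then show "\<exists>z'\<in>M. infnorm (w - z') \<le> \<rho> / 2" using w'(2) by blast
  qed
  then obtain w where w: "w \<in> M" "infnorm (z2 - w) \<le> \<rho> / 2" by blast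
  have "infnorm (z2' - w) < (real 1 + 1) * \<rho>"
    using w(2) z2(3) infnorm_triangle3[of z2' w z2] infnorm_sub[of z2 z2'] rho_pos by simp
  then have "infnorm (z2' - w) \<le> \<rho>"
    using grid_infnorm_le[OF z2(2) _ rho_pos, of w 1] w(1) M_grid by auto
  then have "z2' \<in> M" using move[OF w(1) near[OF z2(1) w(2)] z2(2)] by blast
  then have "c \<in> M"
    using move[OF _ near[OF z2(1,3)] c(1)] z2(4) infnorm_sub[of c z2'] by simp
  then show False using c(2) by blast
qed

end

theorem theorem15:
  fixes F :: "real ^ 'n \<Rightarrow> (real ^ 'n) set"
    and \<Phi> \<Phi>bd :: "real ^ 'n \<Rightarrow> (real ^ 'n) set"
    and L h \<rho> \<alpha> \<beta> \<kappa> :: real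
    and M S00 S0m1 S1 :: "(real ^ 'n) set"
  assumes F_nonempty: "\<And>x. F x \<noteq> {}"
    and F_convex: "\<And>x. convex (F x)"
    and F_compact: "\<And>x. compact (F x)"
    and F_lipschitz: "set_lipschitz L F"
    and L_pos: "0 < L"
    and h_pos: "0 < h"
    and h_le: "h \<le> 1 / (4 * L)"
    and rho_pos: "0 < \<rho>"
    and alpha_eq: "\<alpha> = (1 + L * h) * \<rho> / 2"
    and beta_nonneg: "0 \<le> \<beta>"
    and beta_less: "\<beta> < min ((1 - 3 * L * h) * \<rho>) ((1 - L * h) * \<rho> / 2)"
    and Phi_lower: "\<And>x. blown_euler_map F h \<alpha> x \<subseteq> \<Phi> x"
    and Phi_upper: "\<And>x. \<Phi> x \<subseteq> max_nbhd \<beta> (blown_euler_map F h \<alpha> x)"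
    and Phi_bd_lower: "\<And>x. blown_boundary_euler_map F h \<alpha> x \<subseteq> \<Phi>bd x"
    and Phi_bd_upper: "\<And>x. \<Phi>bd x \<subseteq> max_nbhd \<beta> (blown_boundary_euler_map F h \<alpha> x)"
    and M_grid: "M \<subseteq> grid \<rho>"
    and M_compact: "compact M"
    and M_chain_connected: "chain_connected \<rho> M"
    and kappa_eq: "\<kappa> = (2 + 2 * L * h) / (1 - L * h) * \<alpha> + (3 + L * h) / (1 - L * h) * \<beta>
                     + 2 * (1 + L * h) * \<rho>"
    and S00_eq: "S00 = (\<Union>x\<in>grid_boundary \<rho> 0 M. \<Phi> x)
                       \<inter> max_nbhd \<kappa> (\<Union>x\<in>grid_boundary \<rho> 0 M. \<Phi>bd x) \<inter> grid \<rho>"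
    and S0m1_eq: "S0m1 = (\<Union>x\<in>grid_boundary \<rho> (- 1) M. \<Phi>bd x) \<inter> grid \<rho>"
    and S1_eq: "S1 = (\<Union>x\<in>grid_boundary \<rho> 1 M \<union> grid_boundary \<rho> 2 M. \<Phi>bd x) \<inter> grid \<rho>"
  shows "grid_boundary \<rho> 1 (\<Union>x\<in>M. \<Phi> x) = {x \<in> S1. max_dist x (S00 \<union> S0m1) = ereal \<rho>}
       \<and> grid_boundary \<rho> 0 (\<Union>x\<in>M. \<Phi> x)
           = {x \<in> S00 \<union> S0m1. max_dist x (grid_boundary \<rho> 1 (\<Union>x\<in>M. \<Phi> x)) = ereal \<rho>}"
proof -
  have Lh: "L * h \<le> 1 / 4" using h_le L_pos by (simp add: field_simps)
  interpret boundary_euler F L h \<Phi> \<Phi>bd \<rho> \<alpha> \<beta> M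
    using assms Lh by unfold_locales auto
  let ?d0 = "grid_boundary \<rho> 0 M"
  \<comment> \<open>Both fractions in \<open>\<kappa>\<close> are at least \<open>1\<close>. The
    first bound serves \<open>d0_sub\<close>, the second \<open>S1_cases\<close>.\<close>
  have kappa: "\<rho> \<le> \<kappa>" "\<alpha> + \<beta> + (1 + L * h) * (2 * \<rho>) \<le> \<kappa>"
  proof -
    have "1 * \<alpha> \<le> (2 + 2 * L * h) / (1 - L * h) * \<alpha>" "1 * \<beta> \<le> (3 + L * h) / (1 - L * h) * \<beta>"
      using Lh Lh_pos alpha_pos beta_nonneg by (intro mult_right_mono; simp add: field_simps)+
    then show le: "\<alpha> + \<beta> + (1 + L * h) * (2 * \<rho>) \<le> \<kappa>"
      unfolding kappa_eq by (simp add: mult_ac)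
    have "\<rho> \<le> (1 + L * h) * (2 * \<rho>)"
      using mult_pos_pos[OF Lh_pos rho_pos] rho_pos by (simp add: algebra_simps)
    then show "\<rho> \<le> \<kappa>" using le alpha_pos beta_nonneg by linarith
  qed
  have d0_M: "?d0 \<subseteq> M" by (auto simp: grid_boundary_0_iff)
  \<comment> \<open>With \<open>d0_sub\<close> this sandwiches the computed set between layer
    \<open>0\<close> of \<open>M'\<close> and the grid points of \<open>M'\<close>.\<close>
  have S0_sub: "S00 \<union> S0m1 \<subseteq> M' \<inter> grid \<rho>"
    using d0_M Phi_bd_minus_1_subset by (auto simp: S00_eq S0m1_eq)
  have d0_sub: "grid_boundary \<rho> 0 M' \<subseteq> S00 \<union> S0m1"
  proof
    fix a assume a: "a \<in> grid_boundary \<rho> 0 M'"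
    then have a_grid: "a \<in> grid \<rho>" by (simp add: grid_boundary_0_iff)
    show "a \<in> S00 \<union> S0m1"
    proof (cases "\<exists>m\<in>?d0. a \<in> \<Phi> m")
      case True
      then obtain m where m: "m \<in> ?d0" "a \<in> \<Phi> m" by blast
      then have "a \<in> max_nbhd \<rho> (\<Phi>bd m)" using grid_boundary_0_image_frontier[OF a] d0_M by blast
      moreover have "\<Phi>bd m \<subseteq> (\<Union>x\<in>?d0. \<Phi>bd x)" using m(1) by blast
      ultimately have "a \<in> max_nbhd \<kappa> (\<Union>x\<in>?d0. \<Phi>bd x)" using max_nbhd_mono kappa(1) by blast
      then show ?thesis using m a_grid by (auto simp: S00_eq)
    next
      case False
      then obtain m where "m \<in> grid_boundary \<rho> (- 1) M" "a \<in> \<Phi>bd m"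
        using grid_boundary_0_image_cases[OF a] by blast
      then show ?thesis using a_grid by (auto simp: S0m1_eq)
    qed
  qed
  have d1_sub: "grid_boundary \<rho> 1 M' \<subseteq> S1"
  proof
    fix x assume "x \<in> grid_boundary \<rho> 1 M'"
    then obtain a m where x: "x \<in> grid \<rho>" "x \<notin> M'" "m \<in> M" "a \<in> \<Phi> m" "infnorm (x - a) \<le> \<rho>"
      by (auto simp: grid_boundary_1_iff[OF rho_pos])
    then obtain z where z: "z \<in> grid \<rho>" "z \<notin> M" "x \<in> \<Phi>bd z" "infnorm (z - m) \<le> 2 * \<rho>"
      using outer_frontier_preimage by metis
    then have "z \<in> grid_boundary \<rho> 1 M \<union> grid_boundary \<rho> 2 M"
      using grid_boundary_12I[OF rho_pos z(1,2) x(3) _ z(4)] x(3) M_grid by blast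
    then show "x \<in> S1" using z(3) x(1) by (auto simp: S1_eq)
  qed
  \<comment> \<open>\<open>S1\<close> may contain points of \<open>M'\<close>. They must belong to
    the computed inner set, so that their distance to it is \<open>0\<close> and the test with
    \<open>\<rho>\<close> rejects them.\<close>
  have S1_cases: "x \<in> S00 \<union> S0m1" if xS: "x \<in> S1" and xM: "x \<in> M'" for x
  proof -
    obtain c where c: "c \<in> grid_boundary \<rho> 1 M \<union> grid_boundary \<rho> 2 M" "x \<in> \<Phi>bd c"
      and x: "x \<in> grid \<rho>"
      using xS by (auto simp: S1_eq)
    note c_layer = grid_boundary_12D[OF rho_pos c(1)]
    obtain m where m: "m \<in> ?d0" "x \<in> \<Phi> m"
      using Phi_bd_outer_cases[OF c(2) c_layer(1,2) xM] by blast
    obtain b where b: "b \<in> ?d0" "infnorm (c - b) \<le> 2 * \<rho>" using c_layer(3) by blast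
    have "frontier (G b) \<subseteq> (\<Union>x\<in>?d0. \<Phi>bd x)"
      using b(1) G_subset_max_nbhd(2)[of b b] max_nbhd_subset_Phi_bd rho_pos
      by (force simp: infnorm_0)
    \<comment> \<open>From \<open>x\<close> to the frontier of \<open>G c\<close> it is at most
      \<open>\<alpha> + \<beta>\<close>, and from there to that of \<open>G b\<close> at most the
      Lipschitz factor times two layers.\<close>
    moreover have "x \<in> max_nbhd (\<alpha> + \<beta> + (1 + L * h) * (2 * \<rho>)) (frontier (G b))"
      using c(2) Phi_bd_near max_nbhd_trans[OF frontier_G_lipschitz[OF b(2)]] by blast
    ultimately have "x \<in> max_nbhd \<kappa> (\<Union>x\<in>?d0. \<Phi>bd x)"
      using max_nbhd_mono kappa(2) by blast
    then show ?thesis using m x by (auto simp: S00_eq)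
  qed
  have S0_grid: "S00 \<union> S0m1 \<subseteq> grid \<rho>" using S0_sub by blast
  have d1_grid: "grid_boundary \<rho> 1 M' \<subseteq> grid \<rho>" by (auto simp: grid_boundary_1_iff[OF rho_pos])
  have "x \<in> grid_boundary \<rho> 1 M' \<longleftrightarrow> x \<in> S1 \<and> max_dist x (S00 \<union> S0m1) = ereal \<rho>" for x
  proof
    assume x: "x \<in> grid_boundary \<rho> 1 M'"
    then obtain a where xa: "x \<in> grid \<rho>" "x \<notin> M'" "a \<in> M'" "a \<in> grid \<rho>" "infnorm (x - a) = \<rho>"
      unfolding grid_boundary_1_iff[OF rho_pos] by blast
    then have "a \<in> grid_boundary \<rho> 0 M'" unfolding grid_boundary_0_iff by blast
    then have "a \<in> S00 \<union> S0m1" using d0_sub by blast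
    moreover have "\<rho> \<le> infnorm (x - b)" if "b \<in> S00 \<union> S0m1" for b
      using grid_infnorm_ge[OF xa(1) _ rho_pos, of b] that S0_sub xa(2) by blast
    ultimately show "x \<in> S1 \<and> max_dist x (S00 \<union> S0m1) = ereal \<rho>"
      using d1_sub x xa(5) max_dist_grid_eq_iff[OF xa(1) S0_grid rho_pos] by blast
  next
    assume x: "x \<in> S1 \<and> max_dist x (S00 \<union> S0m1) = ereal \<rho>"
    then have x_grid: "x \<in> grid \<rho>" by (simp add: S1_eq)
    then obtain a where a: "a \<in> S00 \<union> S0m1" "infnorm (x - a) = \<rho>"
      and ge: "\<And>b. b \<in> S00 \<union> S0m1 \<Longrightarrow> \<rho> \<le> infnorm (x - b)"
      using x max_dist_grid_eq_iff[OF x_grid S0_grid rho_pos] by blast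
    have "x \<notin> S00 \<union> S0m1" using ge[of x] rho_pos by (auto simp: infnorm_0)
    then have "x \<notin> M'" using S1_cases x by blast
    then show "x \<in> grid_boundary \<rho> 1 M'"
      using x_grid a S0_sub unfolding grid_boundary_1_iff[OF rho_pos] by blast
  qed
  moreover have "x \<in> grid_boundary \<rho> 0 M' \<longleftrightarrow>
      x \<in> S00 \<union> S0m1 \<and> max_dist x (grid_boundary \<rho> 1 M') = ereal \<rho>" for x
  proof
    assume x: "x \<in> grid_boundary \<rho> 0 M'"
    then obtain y where y: "x \<in> M'" "x \<in> grid \<rho>" "y \<in> grid \<rho>" "y \<notin> M'" "infnorm (y - x) = \<rho>"
      unfolding grid_boundary_0_iff by blast
    then have "y \<in> grid_boundary \<rho> 1 M'" unfolding grid_boundary_1_iff[OF rho_pos] by blast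
    moreover have "infnorm (x - y) = \<rho>" using y(5) by (simp add: infnorm_sub)
    moreover have "\<rho> \<le> infnorm (x - b)" if "b \<in> grid_boundary \<rho> 1 M'" for b
      using grid_infnorm_ge[OF y(2) _ rho_pos, of b] that y(1)
      unfolding grid_boundary_1_iff[OF rho_pos] by blast
    ultimately show "x \<in> S00 \<union> S0m1 \<and> max_dist x (grid_boundary \<rho> 1 M') = ereal \<rho>"
      using x d0_sub max_dist_grid_eq_iff[OF y(2) d1_grid rho_pos] by blast
  next
    assume x: "x \<in> S00 \<union> S0m1 \<and> max_dist x (grid_boundary \<rho> 1 M') = ereal \<rho>"
    then have xM: "x \<in> M'" "x \<in> grid \<rho>" using S0_sub by blast+
    then obtain y where "y \<in> grid_boundary \<rho> 1 M'" "infnorm (x - y) = \<rho>"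
      using x max_dist_grid_eq_iff[OF xM(2) d1_grid rho_pos] by blast
    then have "y \<in> grid_boundary \<rho> 1 M'" "infnorm (y - x) = \<rho>" by (simp_all add: infnorm_sub)
    then show "x \<in> grid_boundary \<rho> 0 M'"
      using xM unfolding grid_boundary_0_iff grid_boundary_1_iff[OF rho_pos] by blast
  qed
  ultimately show ?thesis by blast
qed

end
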